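(* Let $q$ be a power of a prime $p$, $s\ge1$, and let $N>1$ be an integer with $N-1\mid q^s-1$ and $p\mid N$. Let $1\le d_1,d_2\le N-1$ be such that $d_i\in\mathcal{B}$ for $i=1,2$. For $i=1,2$ let $\Delta_{d_i}=\{0,1,\dots,d_i\}$ and $\Delta_{d_i}'=\Delta_{d_i}\setminus\{d_i\}$. If $((\Delta'_{d_1})_{\mathfrak{I}})^\perp\subset(\Delta'_{d_2})_{\mathfrak{I}}$, then there is an asymmetric EAQECC with parameters $$\Big[\Big[N+1,\ \sum_{b\in\mathcal{B},\,b<d_1}n_b+\sum_{b\in\mathcal{B},\,b<d_2}n_b+2-N,\ \delta_z/\delta_x;\ 1\Big]\Big]_q,$$ where $\delta_z\ge N-d_1+1$ and $\delta_x\ge N-d_2+1$.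
   Context: Cyclotomic sets. Let $\mathbb{Z}_N=\{0\}\cup\mathbb{Z}/\langle N-1\rangle$, where the classes of $\mathbb{Z}/\langle N-1\rangle$ are represented by $\{1,\dots,N-1\}$ (so $0$ and $N-1$ are distinct and $q\cdot0=0$); $\mathbb{Z}_N$ is identified with $\{0,1,\dots,N-1\}$. For $z\in\mathbb{Z}_N$, $\mathfrak{I}_z=\{q^i\cdot z: i\ge 0\}$ is the minimal cyclotomic set of $z$ with respect to $q$, and $n_z=|\mathfrak{I}_z|$. $\mathcal{B}$ is the set of maximal representatives (largest elements) of the minimal cyclotomic sets. For $\Gamma\subset\{0,\dots,N-1\}$: $\Gamma_{\mathfrak{I}}$ is the union of all minimal cyclotomic sets contained in $\Gamma$, and $\Gamma^\perp=\{\alpha\in\{0,\dots,N-1\}:\alpha\ne N-1-h\text{ for all }h\in\Gamma\}$. Asymmetric EAQECC, standard definition. Let $H=\mathbb{C}^q$ with orthonormal basis $\{|x\rangle: x\in\mathbb{F}_q\}$ and $|\Phi\rangle=q^{-1/2}\sum_{x\in\mathbb{F}_q}|x\rangle|x\rangle\in H\otimes H$. An EAQECC encoding $\kappa$ qudits into $n$ qudits using $c$ maximally entangled pairs ($\kappa,c\ge0$, $\kappa+c\le n$) is a subspace $Q\subset H^{\otimes n}\otimes H^{\otimes c}$ of the form $\{(U\otimes I)(|\psi\rangle\otimes|0\rangle^{\otimes(n-\kappa-c)}\otimes|\Phi\rangle^{\otimes c}):|\psi\rangle\in H^{\otimes\kappa}\}$, where the first factor $H^{\otimes n}$ consists of the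 sender's qudits (including the sender's halves of the $c$ pairs), the last factor $H^{\otimes c}$ consists of the receiver's (noiseless) halves, and $U$ is a unitary on $H^{\otimes n}$. For $a,b\in\mathbb{F}_q^n$ let $X(a)|x\rangle=|x+a\rangle$ and $Z(b)|x\rangle=\omega^{\mathrm{tr}(b\cdot x)}|x\rangle$ ($x\in\mathbb{F}_q^n$), with $\omega$ a primitive complex $p$-th root of unity and $\mathrm{tr}$ the trace $\mathbb{F}_q\to\mathbb{F}_p$. The asymmetric EAQECC has parameters $[[n,\kappa,\delta_z/\delta_x;c]]_q$, with phase-shift distance (at least) $\delta_z$ and qudit-flip distance (at least) $\delta_x$, if, with $P$ the orthogonal projector onto $Q$, $P(X(a)Z(b)\otimes I)P\in\mathbb{C}P$ for all $a,b\in\mathbb{F}_q^n$ with Hamming weights $\mathrm{wt}(a)<\delta_x$ and $\mathrm{wt}(b)<\delta_z$. *)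

theory Defs
  imports "HOL-Analysis.Analysis" "HOL-Computational_Algebra.Primes"
begin

section \<open>Cyclotomic sets\<close>

text \<open>
  The action of a positive integer \<open>k\<close> on \<open>{0} \<union> \<int>/\<langle>N-1\<rangle>\<close>, where the residue classes are
  represented by \<open>1, \<dots>, N-1\<close> (rather than \<open>0, \<dots>, N-2\<close>) and the extra element \<open>0\<close> is fixed.
\<close>

definition cyc_mult :: "nat \<Rightarrow> nat \<Rightarrow> nat \<Rightarrow> nat" where
  "cyc_mult N k z =
     (if z = 0 then 0
      else if (k * z) mod (N - 1) = 0 then N - 1
      else (k * z) mod (N - 1))"

definition min_cyc :: "nat \<Rightarrow> nat \<Rightarrow> nat \<Rightarrow> nat set" where
  "min_cyc N q z = {cyc_mult N (q ^ i) z |i. True}"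

definition max_reps :: "nat \<Rightarrow> nat \<Rightarrow> nat set" where
  "max_reps N q = {Max (min_cyc N q z) |z. z < N}"

definition cyc_part :: "nat \<Rightarrow> nat \<Rightarrow> nat set \<Rightarrow> nat set" where
  "cyc_part N q \<Gamma> = \<Union> {min_cyc N q z |z. z < N \<and> min_cyc N q z \<subseteq> \<Gamma>}"

definition perp :: "nat \<Rightarrow> nat set \<Rightarrow> nat set" where
  "perp N \<Gamma> = {\<alpha>. \<alpha> < N \<and> (\<forall>h\<in>\<Gamma>. \<alpha> \<noteq> N - 1 - h)}"


section \<open>Qudit spaces\<close>

text \<open>
  The space \<open>H\<^sup>\<otimes>\<^sup>m\<close>, with orthonormal basis \<open>|x\<rangle>\<close> for \<open>x \<in> F\<^sub>q\<^sup>m\<close>, is the space of complex functions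
  on lists that vanish off the lists of length \<open>m\<close>; a vector is identified with its coordinates
  in this basis. Thus \<open>H\<^sup>\<otimes>\<^sup>m \<otimes> H\<^sup>\<otimes>\<^sup>k\<close> is \<open>H\<^sup>\<otimes>\<^sup>m\<^sup>+\<^sup>k\<close>, a pair of words being their concatenation.
\<close>

type_synonym 'f qvec = "'f list \<Rightarrow> complex"

definition words :: "nat \<Rightarrow> 'f list set" where
  "words m = {x. length x = m}"

definition qspace :: "nat \<Rightarrow> 'f qvec set" where
  "qspace m = {\<psi>. \<forall>x. x \<notin> words m \<longrightarrow> \<psi> x = 0}"

definition ket :: "'f list \<Rightarrow> 'f qvec" where
  "ket x = (\<lambda>z. if z = x then 1 else 0)"

definition qinner :: "nat \<Rightarrow> 'f qvec \<Rightarrow> 'f qvec \<Rightarrow> complex" where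
  "qinner m \<phi> \<psi> = (\<Sum>x\<in>words m. cnj (\<phi> x) * \<psi> x)"

text \<open>The linear operator on \<open>H\<^sup>\<otimes>\<^sup>m\<close> that sends \<open>|x\<rangle>\<close> to \<open>f x\<close>.\<close>

definition lin_ext :: "nat \<Rightarrow> ('f list \<Rightarrow> 'f qvec) \<Rightarrow> 'f qvec \<Rightarrow> 'f qvec" where
  "lin_ext m f \<psi> = (\<lambda>z. \<Sum>x\<in>words m. \<psi> x * f x z)"

text \<open>\<open>tensor m \<phi> \<psi>\<close> is \<open>\<phi> \<otimes> \<psi>\<close> for \<open>\<phi>\<close> in \<open>H\<^sup>\<otimes>\<^sup>m\<close> and \<open>\<psi>\<close> in any \<open>H\<^sup>\<otimes>\<^sup>k\<close>.\<close>

definition tensor :: "nat \<Rightarrow> 'f qvec \<Rightarrow> 'f qvec \<Rightarrow> 'f qvec" where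
  "tensor m \<phi> \<psi> = (\<lambda>z. \<phi> (take m z) * \<psi> (drop m z))"

text \<open>The operator \<open>A \<otimes> I\<close> on \<open>H\<^sup>\<otimes>\<^sup>n \<otimes> H\<^sup>\<otimes>\<^sup>c\<close>.\<close>

definition tensor_id :: "nat \<Rightarrow> nat \<Rightarrow> ('f qvec \<Rightarrow> 'f qvec) \<Rightarrow> 'f qvec \<Rightarrow> 'f qvec" where
  "tensor_id n c A = lin_ext (n + c) (\<lambda>z. tensor n (A (ket (take n z))) (ket (drop n z)))"

definition unitary_on :: "nat \<Rightarrow> ('f qvec \<Rightarrow> 'f qvec) \<Rightarrow> bool" where
  "unitary_on n U \<longleftrightarrow>
     U ` qspace n = qspace n \<and>
     (\<forall>\<phi>\<in>qspace n. \<forall>\<psi>\<in>qspace n. \<forall>a b.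
        U (\<lambda>x. a * \<phi> x + b * \<psi> x) = (\<lambda>x. a * U \<phi> x + b * U \<psi> x)) \<and>
     (\<forall>\<phi>\<in>qspace n. \<forall>\<psi>\<in>qspace n. qinner n (U \<phi>) (U \<psi>) = qinner n \<phi> \<psi>)"

text \<open>The orthogonal projection of \<open>v\<close> in \<open>H\<^sup>\<otimes>\<^sup>m\<close> onto the subspace \<open>Q\<close>.\<close>

definition orth_projector :: "nat \<Rightarrow> 'f qvec set \<Rightarrow> 'f qvec \<Rightarrow> 'f qvec" where
  "orth_projector m Q v =
     (THE w. w \<in> Q \<and> (\<forall>u\<in>Q. qinner m u (\<lambda>x. v x - w x) = 0))"


section \<open>Errors\<close>

definition hamming_weight :: "'f::zero list \<Rightarrow> nat" where
  "hamming_weight a = card {i. i < length a \<and> a ! i \<noteq> 0}"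

definition dot :: "'f::comm_semiring_1 list \<Rightarrow> 'f list \<Rightarrow> 'f" where
  "dot a x = (\<Sum>i<length a. a ! i * x ! i)"

definition abs_degree :: "'f::finite_field itself \<Rightarrow> nat" where
  "abs_degree _ = (THE r. CARD('f) = CHAR('f) ^ r)"

definition field_trace :: "'f::finite_field \<Rightarrow> 'f" where
  "field_trace x = (\<Sum>i<abs_degree TYPE('f). x ^ (CHAR('f) ^ i))"

text \<open>The trace lies in the prime field; its value there, as an element of \<open>{0, \<dots>, p-1}\<close>.\<close>

definition trace_rep :: "'f::finite_field \<Rightarrow> nat" where
  "trace_rep x = (THE k. k < CHAR('f) \<and> of_nat k = field_trace x)"

definition X_op :: "nat \<Rightarrow> 'f::finite_field list \<Rightarrow> 'f qvec \<Rightarrow> 'f qvec" where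
  "X_op n a = lin_ext n (\<lambda>x. ket (map2 (+) x a))"

definition Z_op :: "complex \<Rightarrow> nat \<Rightarrow> 'f::finite_field list \<Rightarrow> 'f qvec \<Rightarrow> 'f qvec" where
  "Z_op \<omega> n b = lin_ext n (\<lambda>x z. \<omega> ^ trace_rep (dot b x) * ket x z)"


section \<open>Asymmetric entanglement-assisted codes\<close>

definition Phi :: "'f::finite_field qvec" where
  "Phi = (\<lambda>z. complex_of_real (1 / sqrt (real CARD('f))) * (\<Sum>x\<in>UNIV. ket [x, x] z))"

text \<open>
  \<open>|\<Phi>\<rangle>\<^sup>\<otimes>\<^sup>c\<close> with its factors reordered so that the \<open>c\<close> sender halves precede the \<open>c\<close> receiver
  halves: the \<open>i\<close>-th pair occupies the positions \<open>i\<close> and \<open>c + i\<close>.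
\<close>

definition Phi_power :: "nat \<Rightarrow> 'f::finite_field qvec" where
  "Phi_power c = (\<lambda>z. if z \<in> words (2 * c) then \<Prod>i<c. Phi [z ! i, z ! (c + i)] else 0)"

text \<open>In \<open>H\<^sup>\<otimes>\<^sup>n\<^sup>+\<^sup>c\<close>, the first \<open>n\<close> qudits are the sender's, the last \<open>c\<close> the receiver's.\<close>

definition eaqecc :: "nat \<Rightarrow> nat \<Rightarrow> nat \<Rightarrow> 'f::finite_field qvec set \<Rightarrow> bool" where
  "eaqecc n \<kappa> c Q \<longleftrightarrow>
     \<kappa> + c \<le> n \<and>
     (\<exists>U. unitary_on n U \<and>
        Q = {tensor_id n c U
               (tensor \<kappa> \<psi> (tensor (n - \<kappa> - c) (ket (replicate (n - \<kappa> - c) 0)) (Phi_power c)))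
             |\<psi>. \<psi> \<in> qspace \<kappa>})"

definition asymmetric_eaqecc ::
  "complex \<Rightarrow> nat \<Rightarrow> nat \<Rightarrow> nat \<Rightarrow> nat \<Rightarrow> nat \<Rightarrow> 'f::finite_field qvec set \<Rightarrow> bool" where
  "asymmetric_eaqecc \<omega> n \<kappa> \<delta>z \<delta>x c Q \<longleftrightarrow>
     eaqecc n \<kappa> c Q \<and>
     (\<forall>a\<in>words n. \<forall>b\<in>words n. hamming_weight a < \<delta>x \<longrightarrow> hamming_weight b < \<delta>z \<longrightarrow>
        (\<exists>\<mu>. \<forall>v\<in>qspace (n + c).
           orth_projector (n + c) Q
             (tensor_id n c (X_op n a \<circ> Z_op \<omega> n b) (orth_projector (n + c) Q v))
           = (\<lambda>z. \<mu> * orth_projector (n + c) Q v z)))"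

end

theory Submission
  imports "HOL-Algebra.Algebraic_Closure_Type" "HOL-Number_Theory.Residues" Defs
begin

text \<open>
  Let \<open>C\<^sub>i\<close> be the \<open>F\<^sub>q\<close>-valued evaluations, at the \<open>N\<close> roots of \<open>x\<^sup>N - x\<close>, of the polynomials
  supported on the cyclotomic part of \<open>{0, \<dots>, d\<^sub>i - 1}\<close>, and let \<open>v\<^sub>i\<close> be the evaluation of the sum of
  \<open>x\<^sup>z\<close> over the cyclotomic set of \<open>d\<^sub>i\<close>. Since \<open>v\<^sub>i\<close> comes from a monic polynomial of degree \<open>d\<^sub>i\<close>, the
  extended code \<open>C\<^sub>i \<times> 0 + \<langle>(v\<^sub>i, 1)\<rangle>\<close> of length \<open>N + 1\<close> has minimum distance at least \<open>N - d\<^sub>i + 1\<close>. By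
  hypothesis \<open>C\<^sub>1\<^sup>\<bottom> \<subseteq> C\<^sub>2\<close>, so the dual of the first extended code,
  \<open>{(y, - \<langle>y, v\<^sub>1\<rangle>) | y \<in> C\<^sub>1\<^sup>\<bottom>}\<close>, meets the second one in codimension 1 (where \<open>\<langle>y, v\<^sub>1\<rangle> = 0\<close>), and
  the CSS construction needs exactly one maximally entangled pair.
\<close>

section \<open>Unitaries and orthogonal projections\<close>

text \<open>The evaluation points lie in extensions of F_q, while the words have entries in F_q. A
  polynomial with exponents below \<open>N\<close> is F_q-valued on the points exactly if its
  coefficients satisfy \<open>c (T i) = c i ^ q\<close>, where \<open>T\<close> multiplies exponents
  by \<open>q\<close>. Hence only whole cyclotomic sets count, and \<open>d\<close> has to be a
  maximal representative: then the sum over its cyclotomic set has degree exactly \<open>d\<close>.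
  The divisibility of \<open>N\<close> by \<open>p\<close> is the source of three facts:
  \<open>x ^ N - x\<close> is separable, so there are \<open>N\<close> points; \<open>q\<close> is
  prime to \<open>N - 1\<close>, so \<open>T\<close> is a permutation; and
  \<open>N * x ^ (N - 1) = 0\<close>, so the monomials with exponents \<open>i\<close> and
  \<open>N - 1 - i\<close> are paired, which is where \<open>perp\<close> comes from. The pair is
  treated inside classical codes of length \<open>N + 2\<close>, whose last symbol \<tau> belongs to
  the receiver. In \<open>S\<close> the coefficient of \<open>v2\<close> is the sum \<beta> + \<tau>
  of the last two symbols: it vanishes on the words of \<open>G\<close>, where \<beta> = -\<tau>,
  which puts \<open>G\<close> into \<open>S\<close>; and it equals \<beta> where \<tau> = 0, which
  is the second extended code. Flips never touch the receiver's symbol, so only words with \<tau> =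
  0 matter for them.\<close>

lemma finite_words [simp]: "finite (words n :: 'f::finite list set)"
  using finite_lists_length_eq[of "UNIV :: 'f set" n] by (simp add: words_def)

lemma card_words: "card (words n :: 'f::finite list set) = CARD('f) ^ n"
  using card_lists_length_eq[of "UNIV :: 'f set" n] by (simp add: words_def)

lemma qinner_lincomb_right:
  "qinner n \<xi> (\<lambda>x. c * \<phi> x + d * \<psi> x) = c * qinner n \<xi> \<phi> + d * qinner n \<xi> \<psi>"
  by (simp add: qinner_def sum.distrib sum_distrib_left algebra_simps)

lemma qinner_commute: "qinner n \<phi> \<psi> = cnj (qinner n \<psi> \<phi>)"
  by (simp add: qinner_def mult.commute)

lemma qinner_lincomb_left:
  "qinner n (\<lambda>x. c * \<phi> x + d * \<psi> x) \<xi> = cnj c * qinner n \<phi> \<xi> + cnj d * qinner n \<psi> \<xi>"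
  by (simp add: qinner_def sum.distrib sum_distrib_left algebra_simps)

lemma qinner_sum_right:
  "qinner n \<xi> (\<lambda>z. \<Sum>x\<in>I. c x * f x z) = (\<Sum>x\<in>I. c x * qinner n \<xi> (f x))"
  unfolding qinner_def sum_distrib_left by (subst sum.swap) (simp add: algebra_simps)

lemma qinner_sum_left:
  "qinner n (\<lambda>z. \<Sum>x\<in>I. c x * f x z) \<xi> = (\<Sum>x\<in>I. cnj (c x) * qinner n (f x) \<xi>)"
  by (subst qinner_commute) (simp add: qinner_sum_right flip: qinner_commute)

lemma qinner_self_eq_0:
  fixes \<phi> :: "'f::finite qvec"
  assumes "\<phi> \<in> qspace n" "qinner n \<phi> \<phi> = 0"
  shows "\<phi> = (\<lambda>x. 0)"
proof
  fix x
  have "complex_of_real (\<Sum>x\<in>words n. (cmod (\<phi> x))\<^sup>2) = 0"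
    using assms(2) unfolding of_real_sum complex_norm_square by (simp add: qinner_def mult.commute)
  then have "(\<Sum>x\<in>words n. (cmod (\<phi> x))\<^sup>2) = 0"
    using of_real_eq_0_iff by blast
  then have "\<forall>x\<in>words n. (cmod (\<phi> x))\<^sup>2 = 0"
    by (subst (asm) sum_nonneg_eq_0_iff) auto
  then show "\<phi> x = 0"
    using assms(1) by (cases "x \<in> words n") (auto simp: qspace_def)
qed

lemma qspace_lincomb:
  "\<phi> \<in> qspace n \<Longrightarrow> \<psi> \<in> qspace n \<Longrightarrow> (\<lambda>x. c * \<phi> x + d * \<psi> x) \<in> qspace n"
  by (simp add: qspace_def)

lemma ket_in_qspace: "x \<in> words n \<Longrightarrow> ket x \<in> qspace n"
  by (auto simp: qspace_def ket_def)

lemma qinner_ket: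
  "x \<in> words n \<Longrightarrow> qinner n (ket (x :: 'f::finite list)) (ket y) = (if x = y then 1 else 0)"
  unfolding qinner_def ket_def
  by (subst sum.mono_neutral_right[of _ "{x}"]) auto

lemma unitary_on_id: "unitary_on n (\<lambda>\<phi>. \<phi>)"
  by (simp add: unitary_on_def)

lemma unitary_on_closed: "unitary_on n U \<Longrightarrow> \<phi> \<in> qspace n \<Longrightarrow> U \<phi> \<in> qspace n"
  by (auto simp: unitary_on_def)

lemma unitary_on_comp:
  assumes U: "unitary_on n U" and V: "unitary_on n V"
  shows "unitary_on n (\<lambda>\<phi>. U (V \<phi>))"
proof -
  have "(\<lambda>\<phi>. U (V \<phi>)) ` qspace n = qspace n"
    using U V by (simp add: unitary_on_def flip: image_image)
  then show ?thesis
    using U V unitary_on_closed[OF V] by (simp add: unitary_on_def)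
qed

text \<open>
  With \<open>v = a - b\<close>, the operator \<open>I - v v\<^sup>* / \<langle>v, a\<rangle>\<close> works; it is unitary because
  \<open>\<langle>v, v\<rangle> = \<langle>v, a\<rangle> + \<langle>a, v\<rangle>\<close>.
\<close>

lemma unitary_reflection:
  fixes a b :: "'f::finite qvec"
  assumes a: "a \<in> qspace n" "qinner n a a = 1" and b: "b \<in> qspace n" "qinner n b b = 1"
  obtains U where "unitary_on n U" "U a = b"
    "\<And>\<phi>. qinner n a \<phi> = 0 \<Longrightarrow> qinner n b \<phi> = 0 \<Longrightarrow> U \<phi> = \<phi>"
proof (cases "a = b")
  case True
  then show ?thesis using that[of "\<lambda>\<phi>. \<phi>"] unitary_on_id by auto
next
  case False
  define v where "v = (\<lambda>x. 1 * a x + (-1) * b x)"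
  have v: "v \<in> qspace n" unfolding v_def by (intro qspace_lincomb a b)
  define k where "k = qinner n v a"
  define m where "m = cnj k"
  have vL: "qinner n v \<phi> = qinner n a \<phi> - qinner n b \<phi>" for \<phi>
    unfolding v_def by (subst qinner_lincomb_left) simp
  have vR: "qinner n \<phi> v = qinner n \<phi> a - qinner n \<phi> b" for \<phi>
    unfolding v_def by (subst qinner_lincomb_right) simp
  have vv: "qinner n v v = k + m"
    unfolding k_def m_def by (simp add: vL vR a b flip: qinner_commute)
  have k: "k \<noteq> 0"
  proof
    assume "k = 0"
    then have "v = (\<lambda>x. 0)" using vv v by (intro qinner_self_eq_0[of v n]) (auto simp: m_def)
    then have "a x = b x" for x by (simp add: v_def fun_eq_iff)
    with False show False by auto
  qed
  then have m: "m \<noteq> 0" by (simp add: m_def)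
  \<comment> \<open>Two scalars are needed: \<open>R k\<close> is the unitary, and
    \<open>R m\<close>, with the conjugate scalar, is its adjoint and hence its inverse, which gives
    surjectivity.\<close>
  define R where "R = (\<lambda>c \<phi> x. 1 * \<phi> x + (- (qinner n v \<phi> / c)) * v x)"
  have closed: "R c \<phi> \<in> qspace n" if "\<phi> \<in> qspace n" for c \<phi>
    unfolding R_def by (intro qspace_lincomb v that)
  have "R k (R m \<phi>) = \<phi>" for \<phi>
  proof
    fix x
    have "qinner n v (R m \<phi>) = qinner n v \<phi> - qinner n v \<phi> / m * (k + m)"
      unfolding R_def by (subst qinner_lincomb_right) (simp add: vv)
    then have "R k (R m \<phi>) x = \<phi> x - qinner n v \<phi> / m * v x
        - (qinner n v \<phi> - qinner n v \<phi> / m * (k + m)) / k * v x"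
      by (subst R_def) (simp add: R_def)
    also have "\<dots> = \<phi> x"
      using k m by (simp add: distrib_left)
    finally show "R k (R m \<phi>) x = \<phi> x" .
  qed
  then have "R k ` qspace n = qspace n"
    using closed by (intro subset_antisym image_subsetI subsetI image_eqI[where x = "R m _"]) (auto simp only:)
  moreover have "R k (\<lambda>x. c * \<phi> x + d * \<psi> x) = (\<lambda>x. c * R k \<phi> x + d * R k \<psi> x)" for c d \<phi> \<psi>
    unfolding R_def by (subst qinner_lincomb_right) (simp add: fun_eq_iff algebra_simps add_divide_distrib)
  moreover have "qinner n (R k \<phi>) (R k \<psi>) = qinner n \<phi> \<psi>" for \<phi> \<psi>
  proof -
    have "qinner n (R k \<phi>) (R k \<psi>) = qinner n \<phi> \<psi> - qinner n v \<psi> / k * qinner n \<phi> v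
       - qinner n \<phi> v / m * (qinner n v \<psi> - qinner n v \<psi> / k * (k + m))"
      unfolding R_def
      by (subst qinner_lincomb_left, subst (1 2) qinner_lincomb_right)
         (simp add: vv m_def flip: qinner_commute)
    also have "\<dots> = qinner n \<phi> \<psi>"
      using k m by (simp add: distrib_left)
    finally show ?thesis .
  qed
  ultimately have "unitary_on n (R k)" by (simp add: unitary_on_def)
  moreover have "R k a = b"
    using k by (simp add: R_def flip: k_def) (simp add: v_def)
  moreover have "R k \<phi> = \<phi>" if "qinner n a \<phi> = 0" "qinner n b \<phi> = 0" for \<phi>
    using that by (simp add: R_def vL)
  ultimately show ?thesis using that by blast
qed

text \<open>By induction: once \<open>U\<close> is right on the earlier vectors, a reflection
  carries \<open>U (a s)\<close> to \<open>b s\<close>. It leaves the earlier \<open>b t\<close>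
  alone because they are orthogonal to both of these vectors.\<close>

lemma unitary_extension:
  fixes a b :: "'i \<Rightarrow> 'f::finite qvec"
  assumes "finite S"
    and "\<And>s. s \<in> S \<Longrightarrow> a s \<in> qspace n" and "\<And>s. s \<in> S \<Longrightarrow> b s \<in> qspace n"
    and "\<And>s t. s \<in> S \<Longrightarrow> t \<in> S \<Longrightarrow> qinner n (a s) (a t) = (if s = t then 1 else 0)"
    and "\<And>s t. s \<in> S \<Longrightarrow> t \<in> S \<Longrightarrow> qinner n (b s) (b t) = (if s = t then 1 else 0)"
  shows "\<exists>U. unitary_on n U \<and> (\<forall>s\<in>S. U (a s) = b s)"
  using assms
proof (induction S)
  case empty
  then show ?case using unitary_on_id by auto
next
  case (insert s S)
  then obtain U where U: "unitary_on n U" "\<forall>t\<in>S. U (a t) = b t" by auto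
  have inner: "qinner n (U \<phi>) (U \<psi>) = qinner n \<phi> \<psi>" if "\<phi> \<in> qspace n" "\<psi> \<in> qspace n" for \<phi> \<psi>
    using U that by (simp add: unitary_on_def)
  have as: "U (a s) \<in> qspace n" "qinner n (U (a s)) (U (a s)) = 1"
    using insert.prems(1,3) unitary_on_closed[OF U(1)] by (auto simp: inner)
  obtain V where V: "unitary_on n V" "V (U (a s)) = b s"
    "\<And>\<phi>. qinner n (U (a s)) \<phi> = 0 \<Longrightarrow> qinner n (b s) \<phi> = 0 \<Longrightarrow> V \<phi> = \<phi>"
    by (rule unitary_reflection[OF as, of "b s"]) (use insert.prems(2,4) in auto)
  have "V (b t) = b t" if "t \<in> S" for t
  proof (rule V(3))
    have "s \<noteq> t" using that insert.hyps by auto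
    then show "qinner n (b s) (b t) = 0" using that insert.prems(4) by simp
    have "qinner n (U (a s)) (U (a t)) = 0"
      using that \<open>s \<noteq> t\<close> insert.prems(1,3) by (simp add: inner)
    then show "qinner n (U (a s)) (b t) = 0" using U that by simp
  qed
  then show ?case using unitary_on_comp[OF V(1) U(1)] V(2) U(2) by auto
qed

section \<open>Projections onto spans of orthonormal systems, and error detection\<close>

lemma orth_projector_eq:
  fixes f :: "'i \<Rightarrow> 'f::finite qvec"
  assumes I: "finite I"
    and orth: "\<And>x y. x \<in> I \<Longrightarrow> y \<in> I \<Longrightarrow> qinner m (f x) (f y) = (if x = y then 1 else 0)"
    and Q: "Q = range (\<lambda>\<psi> z. \<Sum>x\<in>I. \<psi> x * f x z)"
  shows "orth_projector m Q v = (\<lambda>z. \<Sum>x\<in>I. qinner m (f x) v * f x z)"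
  unfolding orth_projector_def
proof (rule the_equality, intro conjI ballI)
  let ?P = "\<lambda>z. \<Sum>x\<in>I. qinner m (f x) v * f x z"
  show "?P \<in> Q" unfolding Q by (rule range_eqI[OF refl])
  have fP: "qinner m (f x) ?P = qinner m (f x) v" if "x \<in> I" for x
    using that I by (simp add: qinner_sum_right orth if_distrib cong: if_cong sum.cong)
  have diff: "qinner m u (\<lambda>x. v x - w x) = qinner m u v - qinner m u w" for u w
    using qinner_lincomb_right[of m u 1 v "-1" w] by simp
  show "qinner m u (\<lambda>x. v x - ?P x) = 0" if "u \<in> Q" for u
    unfolding diff using that unfolding Q by (auto simp: qinner_sum_left fP)
  fix w assume w: "w \<in> Q \<and> (\<forall>u\<in>Q. qinner m u (\<lambda>x. v x - w x) = 0)"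
  then obtain \<psi> where \<psi>: "w = (\<lambda>z. \<Sum>x\<in>I. \<psi> x * f x z)" unfolding Q by auto
  have "\<psi> x = qinner m (f x) v" if "x \<in> I" for x
  proof -
    have "f x z = (\<Sum>y\<in>I. (if y = x then 1 else 0) * f y z)" for z
    proof -
      have "(\<Sum>y\<in>I. (if y = x then 1 else 0) * f y z) = (\<Sum>y\<in>I. if y = x then f y z else 0)"
        by (rule sum.cong) auto
      then show ?thesis using that I by simp
    qed
    then have "f x \<in> Q" unfolding Q by (intro range_eqI[of _ _ "\<lambda>y. if y = x then 1 else 0"]) blast
    then have "qinner m (f x) v = qinner m (f x) w" using w diff by auto
    also have "\<dots> = \<psi> x"
      unfolding \<psi> using that I by (simp add: qinner_sum_right orth if_distrib cong: if_cong sum.cong)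
    finally show ?thesis ..
  qed
  then show "w = ?P" unfolding \<psi> by simp
qed

lemma lin_ext_sum:
  "lin_ext m g (\<lambda>z. \<Sum>x\<in>I. c x * f x z) = (\<lambda>z. \<Sum>x\<in>I. c x * lin_ext m g (f x) z)"
  unfolding lin_ext_def sum_distrib_left sum_distrib_right
  by (subst sum.swap) (simp add: mult.assoc)

text \<open>The Knill-Laflamme criterion, tested on an orthonormal basis of \<open>Q\<close>: the
  error has a scalar matrix between the basis states, so its compression to \<open>Q\<close> is that
  scalar.\<close>

lemma orth_projector_detects:
  fixes f :: "'i \<Rightarrow> 'f::finite qvec"
  assumes I: "finite I"
    and orth: "\<And>x y. x \<in> I \<Longrightarrow> y \<in> I \<Longrightarrow> qinner m (f x) (f y) = (if x = y then 1 else 0)"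
    and Q: "Q = range (\<lambda>\<psi> z. \<Sum>x\<in>I. \<psi> x * f x z)"
    and KL: "\<And>x y. x \<in> I \<Longrightarrow> y \<in> I \<Longrightarrow>
               qinner m (f x) (lin_ext m g (f y)) = (if x = y then \<mu> else 0)"
  shows "orth_projector m Q (lin_ext m g (orth_projector m Q v))
           = (\<lambda>z. \<mu> * orth_projector m Q v z)"
proof -
  have P: "orth_projector m Q v = (\<lambda>z. \<Sum>x\<in>I. qinner m (f x) v * f x z)" for v
    by (rule orth_projector_eq) (use assms in auto)
  show ?thesis
    unfolding P lin_ext_sum qinner_sum_right
    using I by (simp add: KL if_distrib sum_distrib_left mult_ac cong: if_cong sum.cong)
qed

section \<open>Encoding with one maximally entangled pair\<close>

lemma Phi_power_1: "Phi_power (Suc 0) [t, t'] = (if t = t' then complex_of_real (1 / sqrt (real CARD('f))) else 0)"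
  for t t' :: "'f::finite_field"
proof -
  have "(\<Sum>x\<in>UNIV. ket [x, x] [t, t']) = (\<Sum>x\<in>UNIV. if x = t then if t = t' then 1 else 0 else 0)"
    by (intro sum.cong) (auto simp: ket_def)
  then show ?thesis by (simp add: Phi_power_def words_def Phi_def)
qed

text \<open>The encoder sends the basis state
  \<open>x @ replicate (n - \<kappa> - 1) 0 @ [t]\<close> to \<open>F x t\<close>, where
  \<open>t\<close> is the sender's half of the pair. On the superposition over \<open>t\<close> in
  \<open>Phi\<close> this gives \<open>q ^ (-1/2)\<close> times the sum of \<open>F x t\<close>
  tensored with the receiver's \<open>ket [t]\<close>, which is \<open>f x\<close>. So codewords can
  be encoded as soon as their components for the various receiver symbols are orthonormal on the
  sender's side.\<close>

lemma eaqeccI: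
  fixes F :: "'f::finite_field list \<Rightarrow> 'f \<Rightarrow> 'f qvec"
  assumes n: "\<kappa> + 1 \<le> n"
    and mem: "\<And>x t. x \<in> words \<kappa> \<Longrightarrow> F x t \<in> qspace n"
    and orth: "\<And>x t x' t'. x \<in> words \<kappa> \<Longrightarrow> x' \<in> words \<kappa> \<Longrightarrow>
                 qinner n (F x t) (F x' t') = (if x = x' \<and> t = t' then 1 else 0)"
    and f: "\<And>x z. x \<in> words \<kappa> \<Longrightarrow> f x z = (if z \<in> words (n + 1)
              then complex_of_real (1 / sqrt (real CARD('f))) * F x (last z) (take n z) else 0)"
  shows "eaqecc n \<kappa> 1 (range (\<lambda>\<psi> z. \<Sum>x\<in>words \<kappa>. \<psi> x * f x z))"
proof -
  let ?s = "complex_of_real (1 / sqrt (real CARD('f)))"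
  let ?e = "replicate (n - \<kappa> - 1) (0 :: 'f)"
  let ?S = "words \<kappa> \<times> (UNIV :: 'f set)"
  have w: "x @ ?e @ [t] \<in> words n" if "x \<in> words \<kappa>" for x t
    using that n by (simp add: words_def)
  have ketw: "qinner n (ket (x @ ?e @ [t])) (ket (x' @ ?e @ [t'])) = (if x = x' \<and> t = t' then 1 else 0)"
    if "x \<in> words \<kappa>" "x' \<in> words \<kappa>" for x t x' t'
    unfolding qinner_ket[OF w[OF that(1)]] using that by (simp add: words_def)
  have "\<exists>U. unitary_on n U \<and> (\<forall>s\<in>?S. U (case s of (x, t) \<Rightarrow> ket (x @ ?e @ [t])) = (case s of (x, t) \<Rightarrow> F x t))"
  proof (rule unitary_extension)
    show "(case s of (x, t) \<Rightarrow> ket (x @ ?e @ [t])) \<in> qspace n" if "s \<in> ?S" for s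
      using that n by (auto simp: words_def intro!: ket_in_qspace)
    show "qinner n (case s of (x, t) \<Rightarrow> ket (x @ ?e @ [t])) (case s' of (x, t) \<Rightarrow> ket (x @ ?e @ [t])) = (if s = s' then 1 else 0)"
      if "s \<in> ?S" "s' \<in> ?S" for s s'
      using that ketw by (cases s; cases s') auto
  qed (use mem orth in \<open>auto split: if_splits\<close>)
  then obtain U where U: "unitary_on n U" "\<And>x t. x \<in> words \<kappa> \<Longrightarrow> U (ket (x @ ?e @ [t])) = F x t"
    by auto
  have closed: "U (ket x) z = 0" if "x \<in> words n" "z \<notin> words n" for x z
    using unitary_on_closed[OF U(1) ket_in_qspace[OF that(1)]] that(2) by (simp add: qspace_def)
  have eq: "tensor_id n 1 U (tensor \<kappa> \<psi> (tensor (n - \<kappa> - 1) (ket ?e) (Phi_power 1)))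
          = (\<lambda>z. \<Sum>x\<in>words \<kappa>. \<psi> x * f x z)" (is "?L = ?R") for \<psi>
  proof
    fix z
    define h where "h y = \<psi> (take \<kappa> y) * (ket ?e (take (n - \<kappa> - 1) (drop \<kappa> y)) *
        Phi_power 1 (drop (n - \<kappa> - 1) (drop \<kappa> y))) *
        (U (ket (take n y)) (take n z) * ket (drop n y) (drop n z))" for y
    let ?y = "\<lambda>(x, t). x @ ?e @ [t, t]"
    \<comment> \<open>The factor \<open>ket ?e\<close> forces the ancillas to be 0 and
      \<open>Phi_power\<close> forces the two halves of the pair to agree, so only the words
      \<open>?y (x, t)\<close> contribute.\<close>
    have h0: "h y = 0" if "y \<in> words (n + 1)" "y \<notin> ?y ` ?S" for y
    proof (rule ccontr)
      assume "h y \<noteq> 0"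
      then have nz: "take (n - \<kappa> - 1) (drop \<kappa> y) = ?e"
        "Phi_power 1 (drop (n - \<kappa> - 1) (drop \<kappa> y)) \<noteq> 0"
        by (auto simp: h_def ket_def split: if_splits)
      have "length (drop (n - \<kappa> - 1) (drop \<kappa> y)) = 2" using that n by (simp add: words_def)
      moreover have "\<exists>t t'. l = [t, t']" if "length l = 2" for l :: "'f list"
        using that by (auto simp: numeral_2_eq_2 length_Suc_conv)
      ultimately obtain t t' where tt: "drop (n - \<kappa> - 1) (drop \<kappa> y) = [t, t']" by blast
      then have "t = t'" using nz(2) by (simp add: Phi_power_1 split: if_splits)
      then have "y = ?y (take \<kappa> y, t)"
        using nz(1) tt by (metis (no_types, lifting) append_take_drop_id case_prod_conv)
      moreover have "take \<kappa> y \<in> words \<kappa>" using that n by (simp add: words_def)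
      ultimately show False using that(2) by (metis (no_types, lifting) UNIV_I SigmaI imageI)
    qed
    have hy: "h (?y (x, t)) = (if drop n z = [t] then \<psi> x * (?s * F x t (take n z)) else 0)"
      if "x \<in> words \<kappa>" for x t
    proof -
      have parts: "take n (x @ ?e @ [t, t]) = x @ ?e @ [t]" "drop n (x @ ?e @ [t, t]) = [t]"
        "take \<kappa> (x @ ?e @ [t, t]) = x" "take (n - \<kappa> - 1) (drop \<kappa> (x @ ?e @ [t, t])) = ?e"
        "drop (n - \<kappa> - 1) (drop \<kappa> (x @ ?e @ [t, t])) = [t, t]"
        using that n by (auto simp: words_def Suc_diff_le)
      show ?thesis
        unfolding h_def prod.case parts U(2)[OF that] by (simp add: Phi_power_1 ket_def)
    qed
    have "?L z = (\<Sum>y\<in>words (n + 1). h y)"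
      by (simp add: tensor_id_def lin_ext_def tensor_def h_def)
    also have "\<dots> = (\<Sum>y\<in>?y ` ?S. h y)"
    proof (rule sum.mono_neutral_right)
      show "?y ` ?S \<subseteq> words (n + 1)" using n by (auto simp: words_def)
    qed (use h0 in \<open>auto simp del: One_nat_def\<close>)
    also have "\<dots> = (\<Sum>s\<in>?S. h (?y s))"
      by (subst sum.reindex) (auto simp: inj_on_def words_def)
    also have "\<dots> = (\<Sum>x\<in>words \<kappa>. \<Sum>t\<in>UNIV. h (?y (x, t)))"
      by (simp add: sum.cartesian_product case_prod_unfold)
    also have "\<dots> = (\<Sum>x\<in>words \<kappa>. \<psi> x * f x z)"
    proof (rule sum.cong[OF refl])
      fix x :: "'f list" assume x: "x \<in> words \<kappa>"
      have "(\<Sum>t\<in>UNIV. h (?y (x, t)))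
          = (\<Sum>t\<in>UNIV. if drop n z = [t] then \<psi> x * (?s * F x t (take n z)) else 0)"
        using hy[OF x] by simp
      also have "\<dots> = \<psi> x * f x z"
      proof (cases "z \<in> words (n + 1)")
        case True
        then have "drop n z = [last z]"
          by (auto simp: words_def length_Suc_conv_rev)
        then show ?thesis using True by (simp add: f[OF x])
      next
        case False
        have "F x t (take n z) = 0" if "drop n z = [t]" for t
        proof -
          have "length z \<noteq> n + 1" using False by (simp add: words_def)
          moreover have "length (drop n z) = 1" using that by simp
          ultimately show ?thesis by simp
        qed
        then have "(if drop n z = [t] then \<psi> x * (?s * F x t (take n z)) else 0) = 0" for t
          by simp
        then show ?thesis using False by (simp add: f[OF x])
      qed
      finally show "(\<Sum>t\<in>UNIV. h (?y (x, t))) = \<psi> x * f x z" .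
    qed
    finally show "?L z = ?R z" .
  qed
  have "range (\<lambda>\<psi> z. \<Sum>x\<in>words \<kappa>. \<psi> x * f x z)
      = (\<lambda>\<psi> z. \<Sum>x\<in>words \<kappa>. \<psi> x * f x z) ` qspace \<kappa>"
  proof (intro subset_antisym image_subsetI)
    fix \<psi> :: "'f qvec"
    show "(\<lambda>z. \<Sum>x\<in>words \<kappa>. \<psi> x * f x z) \<in> (\<lambda>\<psi> z. \<Sum>x\<in>words \<kappa>. \<psi> x * f x z) ` qspace \<kappa>"
      by (intro image_eqI[where x = "\<lambda>x. if x \<in> words \<kappa> then \<psi> x else 0"]) (auto simp: qspace_def)
  qed auto
  also have "\<dots> = {tensor_id n 1 U (tensor \<kappa> \<psi> (tensor (n - \<kappa> - 1) (ket ?e) (Phi_power 1))) |\<psi>. \<psi> \<in> qspace \<kappa>}"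
    unfolding eq by blast
  finally show ?thesis
    unfolding eaqecc_def using n U(1) by blast
qed

section \<open>Codes from pairs of nested additive groups\<close>

lemma vadd_in_words: "x \<in> words m \<Longrightarrow> y \<in> words m \<Longrightarrow> map2 (+) x y \<in> words m"
  by (simp add: words_def)

lemma vdiff_in_words: "x \<in> words m \<Longrightarrow> y \<in> words m \<Longrightarrow> map2 (-) x y \<in> words m"
  by (simp add: words_def)

lemma dot_add:
  fixes b :: "'f::comm_ring_1 list"
  assumes "x \<in> words n" "y \<in> words n" "b \<in> words n"
  shows "dot b (map2 (+) x y) = dot b x + dot b y"
  using assms by (simp add: dot_def words_def sum.distrib algebra_simps)

text \<open>The appended 0 records that no error reaches the receiver's qudit. The formula for
  \<open>g\<close> is restricted to words of length \<open>n + 1\<close> because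
  \<open>lin_ext\<close> evaluates \<open>g\<close> nowhere else.\<close>

lemma tensor_id_XZ_eq_lin_ext:
  fixes a b :: "'f::finite_field list"
  assumes a: "a \<in> words n"
  shows "\<exists>g. (tensor_id n 1 (X_op n a \<circ> Z_op \<omega> n b) :: 'f qvec \<Rightarrow> 'f qvec) = lin_ext (n + 1) g \<and>
     (\<forall>y\<in>words (n + 1). g y = (\<lambda>z. \<omega> ^ trace_rep (dot b (take n y)) * ket (map2 (+) y (a @ [0])) z))"
proof (intro exI conjI ballI)
  show "(tensor_id n 1 (X_op n a \<circ> Z_op \<omega> n b) :: 'f qvec \<Rightarrow> 'f qvec) = lin_ext (n + 1)
    (\<lambda>z. tensor n ((X_op n a \<circ> Z_op \<omega> n b) (ket (take n z))) (ket (drop n z)))"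
    unfolding tensor_id_def ..
  fix y :: "'f list" assume y: "y \<in> words (n + 1)"
  define w t where "w = take n y" and "t = last y"
  have w: "w \<in> words n" and yw: "y = w @ [t]"
    using y by (auto simp: w_def t_def words_def length_Suc_conv_rev)
  let ?c = "\<omega> ^ trace_rep (dot b w)"
  have Z: "Z_op \<omega> n b (ket w) = (\<lambda>z. ?c * ket w z)"
  proof
    fix z
    have "Z_op \<omega> n b (ket w) z
        = (\<Sum>x\<in>words n. if x = w then ?c * ket w z else 0)"
      unfolding Z_op_def lin_ext_def by (intro sum.cong) (auto simp: ket_def)
    then show "Z_op \<omega> n b (ket w) z = ?c * ket w z" using w by simp
  qed
  have X: "X_op n a (\<lambda>z. ?c * ket w z) = (\<lambda>z. ?c * ket (map2 (+) w a) z)"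
  proof
    fix z
    have "X_op n a (\<lambda>z. ?c * ket w z) z
        = (\<Sum>x\<in>words n. if x = w then ?c * ket (map2 (+) w a) z else 0)"
      unfolding X_op_def lin_ext_def by (intro sum.cong) (auto simp: ket_def)
    then show "X_op n a (\<lambda>z. ?c * ket w z) z = ?c * ket (map2 (+) w a) z" using w by simp
  qed
  have "map2 (+) y (a @ [0]) = map2 (+) w a @ [t]"
    using a w by (simp add: yw words_def)
  moreover have "ket (map2 (+) w a) (take n z) * ket [t] (drop n z) = ket (map2 (+) w a @ [t]) z" for z
    using a w append_take_drop_id[of n z] by (auto simp: ket_def words_def simp del: append_take_drop_id)
  ultimately show "tensor n ((X_op n a \<circ> Z_op \<omega> n b) (ket (take n y))) (ket (drop n y))
      = (\<lambda>z. \<omega> ^ trace_rep (dot b (take n y)) * ket (map2 (+) y (a @ [0])) z)"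
    using w by (auto simp: tensor_def Z X yw words_def fun_eq_iff mult.assoc)
qed

lemma cnj_inverse_sqrt:
  assumes "x > 0"
  shows "cnj (complex_of_real (1 / sqrt x)) * complex_of_real (1 / sqrt x) * complex_of_real x = 1"
proof -
  have "1 / sqrt x * (1 / sqrt x) * x = 1"
    using assms by simp
  then have "complex_of_real (1 / sqrt x * (1 / sqrt x) * x) = 1" by (simp only: of_real_1)
  then show ?thesis by (simp only: of_real_mult complex_cnj_complex_of_real)
qed

text \<open>
  The code is spanned by the uniform superpositions over the cosets of \<open>G\<close> in \<open>S\<close>: flips are detected
  because they leave \<open>S\<close>, phases because they are non-trivial characters of \<open>G\<close>. The last coordinate
  of a word is the receiver's half of the pair.
\<close>

theorem css_asymmetric_eaqecc:
  fixes S G :: "'f::finite_field list set"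
  assumes char_add: "\<And>x y :: 'f. \<omega> ^ trace_rep (x + y) = \<omega> ^ trace_rep x * \<omega> ^ trace_rep y"
    and char_0: "\<omega> ^ trace_rep (0 :: 'f) = 1"
    and char_nontriv: "\<And>x :: 'f. x \<noteq> 0 \<Longrightarrow> \<exists>c. \<omega> ^ trace_rep (c * x) \<noteq> 1"
    and n: "\<kappa> + 1 \<le> n"
    and S: "S \<subseteq> words (n + 1)" "\<And>x y. x \<in> S \<Longrightarrow> y \<in> S \<Longrightarrow> map2 (-) x y \<in> S"
    and G: "G \<subseteq> S" "\<And>x y. x \<in> G \<Longrightarrow> y \<in> G \<Longrightarrow> map2 (-) x y \<in> G"
    and G_scale: "\<And>c x. x \<in> G \<Longrightarrow> map ((*) c) x \<in> G"
    and S_last: "\<And>t. replicate n 0 @ [t] \<in> S \<Longrightarrow> t = 0"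
    and G_last: "\<exists>g\<in>G. last g = 1"
    and card_S: "card S = CARD('f) ^ \<kappa> * card G"
    and x_dist: "\<And>a. a \<in> words n \<Longrightarrow> a @ [0] \<in> S \<Longrightarrow> hamming_weight a < \<delta>x \<Longrightarrow> a = replicate n 0"
    and z_dist: "\<And>b. b \<in> words n \<Longrightarrow> (\<And>g. g \<in> G \<Longrightarrow> dot b (take n g) = 0) \<Longrightarrow>
                   hamming_weight b < \<delta>z \<Longrightarrow> b = replicate n 0"
  shows "\<exists>Q :: 'f qvec set. asymmetric_eaqecc \<omega> n \<kappa> \<delta>z \<delta>x 1 Q"
proof -
  define m where "m = n + 1"
  let ?q = "CARD('f)"
  note SW = S(1)[folded m_def, THEN subsetD]
  have GS: "x \<in> S" if "x \<in> G" for x using that G by auto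
  have GW: "x \<in> words m" if "x \<in> G" for x using that GS SW by blast
  have finS: "finite S" using S(1) finite_subset finite_words by blast
  have finG: "finite G" using G(1) finS finite_subset by blast
  obtain g1 where g1: "g1 \<in> G" "last g1 = 1" using G_last by blast
  have q: "?q > 0" by simp
  have G0: "replicate m 0 \<in> G"
  proof -
    have "map2 (-) g1 g1 = replicate m 0"
      using GW[OF g1(1)] by (auto simp: words_def list_eq_iff_nth_eq)
    then show ?thesis using G(2)[OF g1(1) g1(1)] by simp
  qed
  then have cG: "card G > 0" using finG card_gt_0_iff by blast
  have add_eq: "map2 (+) x y = map2 (-) x (map2 (-) (replicate m 0) y)"
    if "x \<in> words m" "y \<in> words m" for x y :: "'f list"
    using that by (auto simp: words_def list_eq_iff_nth_eq)
  have Gadd: "map2 (+) x y \<in> G" if "x \<in> G" "y \<in> G" for x y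
    using that G(2) G0 by (simp add: add_eq GW)
  have Sadd: "map2 (+) x y \<in> S" if "x \<in> S" "y \<in> S" for x y
    using that S(2) GS[OF G0] by (simp add: add_eq SW)
  have add_diff: "map2 (+) (map2 (-) x y) y = x" "map2 (-) (map2 (+) x y) y = x"
    "map2 (-) (map2 (+) y x) y = x"
    if "x \<in> words m" "y \<in> words m" for x y :: "'f list"
    using that by (auto simp: words_def list_eq_iff_nth_eq)
  define cos where "cos s = {y \<in> words m. map2 (-) y s \<in> G}" for s
  have cosS: "cos s \<subseteq> S" if s: "s \<in> S" for s
  proof
    fix y assume y: "y \<in> cos s"
    then have "map2 (+) (map2 (-) y s) s \<in> S" using s GS by (intro Sadd) (auto simp: cos_def)
    then show "y \<in> S" using y s SW by (simp add: cos_def add_diff)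
  qed
  have cos_shift: "map2 (+) y g \<in> cos s \<longleftrightarrow> y \<in> cos s" if s: "s \<in> S" and y: "y \<in> words m" and g: "g \<in> G" for s y g
  proof -
    have eq: "map2 (-) (map2 (+) y g) s = map2 (+) (map2 (-) y s) g"
      "map2 (-) y s = map2 (-) (map2 (-) (map2 (+) y g) s) g"
      using SW[OF s] y GW[OF g] by (auto simp: words_def list_eq_iff_nth_eq)
    have "map2 (-) (map2 (+) y g) s \<in> G \<longleftrightarrow> map2 (-) y s \<in> G"
      using Gadd[OF _ g] G(2)[OF _ g] eq by metis
    then show ?thesis using y GW[OF g] by (simp add: cos_def vadd_in_words)
  qed
  have cos_self: "s \<in> cos s" if "s \<in> S" for s
  proof -
    have "map2 (-) s s = replicate m 0"
      using SW[OF that] by (auto simp: words_def list_eq_iff_nth_eq)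
    then show ?thesis using G0 SW[OF that] by (simp add: cos_def)
  qed
  have cos_image: "cos s = (\<lambda>g. map2 (+) s g) ` G" if s: "s \<in> S" for s
  proof (intro subset_antisym subsetI)
    fix y assume y: "y \<in> cos s"
    have "y = map2 (+) s (map2 (-) y s)"
      using y SW[OF s] by (auto simp: cos_def words_def list_eq_iff_nth_eq)
    then show "y \<in> (\<lambda>g. map2 (+) s g) ` G" by (rule image_eqI) (use y in \<open>simp add: cos_def\<close>)
  next
    fix y assume "y \<in> (\<lambda>g. map2 (+) s g) ` G"
    then obtain g where "g \<in> G" "y = map2 (+) s g" by blast
    then show "y \<in> cos s" using cos_shift[OF s SW[OF s], of g] cos_self[OF s] by simp
  qed
  have card_cos: "card (cos s) = card G" if s: "s \<in> S" for s
  proof -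
    have "inj_on (\<lambda>g. map2 (+) s g) G"
      by (rule inj_onI) (metis GW SW[OF s] add_diff(3))
    then show ?thesis unfolding cos_image[OF s] by (rule card_image)
  qed
  have cos_eq: "cos s = cos y" if s: "s \<in> S" and y: "y \<in> cos s" for s y
  proof -
    have yS: "y \<in> S" using cosS s y by blast
    have "cos y \<subseteq> cos s"
    proof
      fix z assume "z \<in> cos y"
      then obtain g where "g \<in> G" "z = map2 (+) y g" unfolding cos_image[OF yS] by blast
      then show "z \<in> cos s" using cos_shift[OF s SW[OF yS], of g] y by simp
    qed
    then show ?thesis
      using card_cos[OF s] card_cos[OF yS] cosS[OF s] finS
      by (metis card_subset_eq finite_subset)
  qed
  have "card G * card (cos ` S) = card S"
  proof -
    have "card G * card (cos ` S) = card (\<Union> (cos ` S))"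
    proof (rule card_partition)
      show "c1 \<inter> c2 = {}" if "c1 \<in> cos ` S" "c2 \<in> cos ` S" "c1 \<noteq> c2" for c1 c2
        using that cos_eq by blast
    next
      have "\<Union> (cos ` S) \<subseteq> S" using cosS by blast
      then show "finite (\<Union> (cos ` S))" using finS finite_subset by blast
    qed (use finS card_cos in auto)
    also have "\<Union> (cos ` S) = S" using cosS cos_self by auto
    finally show ?thesis .
  qed
  then have "card (cos ` S) = card (words \<kappa> :: 'f list set)"
    using card_S cG by (simp add: card_words)
  then obtain B where B: "bij_betw B (words \<kappa> :: 'f list set) (cos ` S)"
    using finite_same_card_bij[of "words \<kappa> :: 'f list set" "cos ` S"] finS by auto
  have Brep: "\<exists>s\<in>S. B x = cos s" if "x \<in> words \<kappa>" for x
    using B that unfolding bij_betw_def by blast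
  have Bdisj: "x = x'" if "x \<in> words \<kappa>" "x' \<in> words \<kappa>" "y \<in> B x" "y' \<in> B x'" "y' = y" for x x' y y'
  proof -
    have "B x = B x'" using that Brep[of x] Brep[of x'] cos_eq by metis
    then show ?thesis using B that by (auto simp: bij_betw_def dest: inj_onD)
  qed
  have BW: "B x \<subseteq> words m" if "x \<in> words \<kappa>" for x using Brep[OF that] by (auto simp: cos_def)
  have BS: "B x \<subseteq> S" if "x \<in> words \<kappa>" for x using Brep[OF that] cosS by auto
  have Bshift: "map2 (+) y g \<in> B x \<longleftrightarrow> y \<in> B x" if "x \<in> words \<kappa>" "y \<in> words m" "g \<in> G" for x y g
    using Brep[OF that(1)] cos_shift that by auto
  have cardB: "card (B x) = card G" if "x \<in> words \<kappa>" for x using Brep[OF that] card_cos by auto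
  define C where "C x t = {w \<in> words n. w @ [t] \<in> B x}" for x t
  \<comment> \<open>All receiver symbols are equally frequent in every coset, as a maximally
    entangled pair requires: adding the multiple of \<open>g1\<close> with last symbol
    \<open>t' - t\<close> maps the slice at \<open>t\<close> onto the slice at
    \<open>t'\<close>.\<close>
  have card_C: "?q * card (C x t) = card G" if x: "x \<in> words \<kappa>" for x t
  proof -
    have eq: "card (C x t') = card (C x t)" for t'
    proof -
      define g where "g = map ((*) (t' - t)) g1"
      have g: "g \<in> G" unfolding g_def by (rule G_scale[OF g1(1)])
      define u where "u = take n g"
      have "g \<noteq> []" using GW[OF g] by (auto simp: words_def m_def)
      then have "last g = t' - t" by (simp add: g_def last_map g1)
      then have gu: "g = u @ [t' - t]" and u: "u \<in> words n"
        using GW[OF g] by (auto simp: u_def words_def m_def length_Suc_conv_rev)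
      have iff: "map2 (+) w u \<in> C x t' \<longleftrightarrow> w \<in> C x t" if w: "w \<in> words n" for w
      proof -
        have "map2 (+) (w @ [t]) g = map2 (+) w u @ [t']"
          using w u by (simp add: gu words_def)
        then have "map2 (+) w u @ [t'] \<in> B x \<longleftrightarrow> w @ [t] \<in> B x"
          using Bshift[OF x _ g, of "w @ [t]"] w by (simp add: words_def m_def)
        then show ?thesis using w u by (simp add: C_def vadd_in_words)
      qed
      have inv: "map2 (-) (map2 (+) w u) u = w" "map2 (+) (map2 (-) w u) u = w" if "w \<in> words n" for w
        using that u by (auto simp: words_def list_eq_iff_nth_eq)
      have CW: "w \<in> words n" if "w \<in> C x s" for w s using that by (simp add: C_def)
      have "bij_betw (\<lambda>w. map2 (+) w u) (C x t) (C x t')"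
        by (rule bij_betw_byWitness[where f' = "\<lambda>w. map2 (-) w u"])
           (use inv CW iff vdiff_in_words[OF _ u] in \<open>auto, metis\<close>)
      then show ?thesis by (rule bij_betw_same_card[symmetric])
    qed
    have "(\<Sum>t'\<in>UNIV. card (C x t')) = (\<Sum>t'\<in>(UNIV :: 'f set). card (C x t))"
      by (intro sum.cong refl eq)
    moreover have "card (B x) = card (\<Union>t\<in>UNIV. (\<lambda>w. w @ [t]) ` C x t)"
    proof (rule arg_cong[where f = card], intro subset_antisym subsetI)
      fix y assume y: "y \<in> B x"
      then have "y \<in> words m" using BW x by blast
      then have "y = take n y @ [last y]" "take n y \<in> words n"
        by (auto simp: words_def m_def length_Suc_conv_rev)
      then show "y \<in> (\<Union>t\<in>UNIV. (\<lambda>w. w @ [t]) ` C x t)"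
        using y unfolding C_def by (metis (no_types, lifting) UNIV_I UN_I image_eqI mem_Collect_eq)
    qed (auto simp: C_def)
    moreover have "\<dots> = (\<Sum>t\<in>UNIV. card ((\<lambda>w. w @ [t]) ` C x t))"
      by (rule card_UN_disjoint) (auto simp: C_def)
    moreover have "card ((\<lambda>w. w @ [s]) ` C x s) = card (C x s)" for s
      by (rule card_image) (auto intro: inj_onI)
    ultimately show ?thesis using cardB[OF x] by simp
  qed
  \<comment> \<open>Normalizations: a coset has \<open>card G\<close> words and each of its slices
    has \<open>card G / q\<close>. Their ratio is the factor \<open>q ^ (-1/2)\<close> of
    \<open>Phi\<close>.\<close>
  define cC :: complex where "cC = complex_of_real (1 / sqrt (real (card G) / real ?q))"
  define cB :: complex where "cB = complex_of_real (1 / sqrt (real (card G)))"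
  define F :: "'f list \<Rightarrow> 'f \<Rightarrow> 'f qvec" where "F x t w = (if w \<in> C x t then cC else 0)" for x t w
  define f :: "'f list \<Rightarrow> 'f qvec" where "f x z = (if z \<in> B x then cB else 0)" for x z
  have cB2: "cnj cB * cB * of_nat (card G) = 1"
    using cnj_inverse_sqrt[of "real (card G)"] cG by (simp add: cB_def)
  have cC2: "cnj cC * cC * of_nat (card (C x t)) = 1" if "x \<in> words \<kappa>" for x t
  proof -
    have "real (card G) = real ?q * real (card (C x t))"
      using card_C[OF that, of t] by (simp flip: of_nat_mult)
    then have eq: "real (card G) / real ?q = real (card (C x t))" by simp
    have "real (card G) / real ?q > 0" using cG by simp
    then show ?thesis
      unfolding cC_def eq using cnj_inverse_sqrt[of "real (card (C x t))"] by (simp only: of_real_of_nat_eq)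
  qed
  have F_mem: "F x t \<in> qspace n" for x t
    by (auto simp: F_def qspace_def C_def)
  have ind: "(\<Sum>w\<in>words k. cnj (if w \<in> A then c else 0) * (if w \<in> A then c else 0)) = cnj c * c * of_nat (card A)"
    if "A \<subseteq> words k" for A :: "'f list set" and k and c :: complex
  proof -
    have "(\<Sum>w\<in>words k. cnj (if w \<in> A then c else 0) * (if w \<in> A then c else 0)) = (\<Sum>w\<in>A. cnj c * c)"
      using that by (intro sum.mono_neutral_cong_right) auto
    then show ?thesis by simp
  qed
  have f_orth: "qinner (n + 1) (f x) (f y) = (if x = y then 1 else 0)"
    if "x \<in> words \<kappa>" "y \<in> words \<kappa>" for x y
  proof (cases "x = y")
    case True
    then show ?thesis
      using ind[OF BW[OF that(1)], of cB] cB2 cardB[OF that(1)] by (simp add: qinner_def f_def m_def)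
  next
    case False
    then have "f x z = 0 \<or> f y z = 0" for z using Bdisj[OF that] by (auto simp: f_def)
    then have "qinner (n + 1) (f x) (f y) = 0" unfolding qinner_def by (intro sum.neutral) auto
    then show ?thesis using False by simp
  qed
  have F_orth: "qinner n (F x t) (F x' t') = (if x = x' \<and> t = t' then 1 else 0)"
    if x: "x \<in> words \<kappa>" "x' \<in> words \<kappa>" for x x' t t'
  proof (cases "x = x' \<and> t = t'")
    case True
    then show ?thesis
      using ind[of "C x t" n cC] cC2[OF x(1)] by (simp add: qinner_def F_def C_def)
  next
    case False
    \<comment> \<open>If one sender word occurred with two receiver symbols, the difference of the
      two words would be 0 except at the receiver's place, which \<open>S_last\<close> forbids. So
      the sender's states determine \<open>t\<close> as well as the coset.\<close>
    have "F x t w = 0 \<or> F x' t' w = 0" for w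
    proof (rule ccontr)
      assume "\<not> ?thesis"
      then have w: "w \<in> words n" "w @ [t] \<in> B x" "w @ [t'] \<in> B x'"
        by (auto simp: F_def C_def split: if_splits)
      have "map2 (-) (w @ [t]) (w @ [t']) \<in> S"
        using w BS x by (intro S(2)) auto
      also have "map2 (-) (w @ [t]) (w @ [t']) = replicate n 0 @ [t - t']"
        using w(1) by (auto simp: words_def list_eq_iff_nth_eq nth_append less_Suc_eq)
      finally have "t = t'" using S_last by fastforce
      then show False using False Bdisj[OF x w(2,3)] by simp
    qed
    then have "qinner n (F x t) (F x' t') = 0" unfolding qinner_def by (intro sum.neutral) auto
    then show ?thesis using False by simp
  qed
  define Q where "Q = range (\<lambda>\<psi> z. \<Sum>x\<in>words \<kappa>. \<psi> x * f x z)"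
  have "eaqecc n \<kappa> 1 Q"
    unfolding Q_def
  proof (rule eaqeccI[OF n F_mem F_orth])
    fix x z :: "'f list" assume x: "x \<in> words \<kappa>"
    have c: "cB = complex_of_real (1 / sqrt (real ?q)) * cC"
      unfolding cB_def cC_def by (simp add: real_sqrt_divide flip: of_real_mult)
    have "z \<in> B x \<longleftrightarrow> take n z \<in> C x (last z)" if "z \<in> words (n + 1)"
      using that by (auto simp: C_def words_def length_Suc_conv_rev)
    moreover have "z \<notin> B x" if "z \<notin> words (n + 1)" using that BW[OF x] by (auto simp: m_def)
    ultimately show "f x z = (if z \<in> words (n + 1)
        then complex_of_real (1 / sqrt (real ?q)) * F x (last z) (take n z) else 0)"
      unfolding f_def F_def c by auto
  qed auto
  moreover have "\<exists>\<mu>. \<forall>v\<in>qspace (n + 1). orth_projector (n + 1) Q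
      (tensor_id n 1 (X_op n a \<circ> Z_op \<omega> n b) (orth_projector (n + 1) Q v))
      = (\<lambda>z. \<mu> * orth_projector (n + 1) Q v z)"
    if a: "a \<in> words n" "hamming_weight a < \<delta>x" and b: "b \<in> words n" "hamming_weight b < \<delta>z" for a b
  proof -
    let ?\<chi> = "\<lambda>y. \<omega> ^ trace_rep (dot b (take n y))"
    obtain g where g: "tensor_id n 1 (X_op n a \<circ> Z_op \<omega> n b) = lin_ext (n + 1) g"
      "\<And>y. y \<in> words (n + 1) \<Longrightarrow> g y = (\<lambda>z. ?\<chi> y * ket (map2 (+) y (a @ [0])) z)"
      using tensor_id_XZ_eq_lin_ext[OF a(1), of \<omega> b] by blast
    have aw: "a @ [0] \<in> words m" using a by (simp add: words_def m_def)
    have inner: "qinner m (f x) (lin_ext m g (f y))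
        = (\<Sum>z\<in>words m. f y z * (?\<chi> z * cnj (f x (map2 (+) z (a @ [0])))))" for x y
    proof -
      have k: "qinner m \<phi> (ket w) = cnj (\<phi> w)" if "w \<in> words m" for w and \<phi> :: "'f qvec"
      proof -
        have "qinner m \<phi> (ket w) = (\<Sum>z\<in>words m. if z = w then cnj (\<phi> w) else 0)"
          unfolding qinner_def ket_def by (intro sum.cong) auto
        then show ?thesis using that by simp
      qed
      have "qinner m (f x) (g z) = ?\<chi> z * cnj (f x (map2 (+) z (a @ [0])))" if "z \<in> words m" for z
        using g(2)[of z] that qinner_lincomb_right[of m "f x" "?\<chi> z" "ket (map2 (+) z (a @ [0]))" 0 "\<lambda>_. 0"]
          k[OF vadd_in_words[OF that aw], of "f x"]
        by (simp add: m_def)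
      then show ?thesis unfolding lin_ext_def qinner_sum_right by simp
    qed
    have "\<exists>\<mu>. \<forall>x\<in>words \<kappa>. \<forall>y\<in>words \<kappa>.
        qinner m (f x) (lin_ext m g (f y)) = (if x = y then \<mu> else 0)"
    proof (cases "a = replicate n 0")
      case False
      have "f y z * (?\<chi> z * cnj (f x (map2 (+) z (a @ [0])))) = 0"
        if "x \<in> words \<kappa>" "y \<in> words \<kappa>" "z \<in> words m" for x y z
      proof (rule ccontr)
        assume "\<not> ?thesis"
        then have "z \<in> S" "map2 (+) z (a @ [0]) \<in> S"
          using BS[OF that(1)] BS[OF that(2)] by (auto simp: f_def split: if_splits)
        then have "map2 (-) (map2 (+) z (a @ [0])) z \<in> S" using S(2) by blast
        then have "a @ [0] \<in> S" using add_diff(3)[OF aw that(3)] by simp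
        then show False using x_dist a False by blast
      qed
      then show ?thesis unfolding inner by (intro exI[of _ 0]) (simp add: sum.neutral)
    next
      case True
      have a0: "map2 (+) z (a @ [0]) = z" if "z \<in> words m" for z
        using that by (auto simp: True words_def m_def list_eq_iff_nth_eq nth_append)
      have inner0: "qinner m (f x) (lin_ext m g (f y)) = (\<Sum>z\<in>words m. f y z * (?\<chi> z * cnj (f x z)))" for x y
        unfolding inner by (intro sum.cong) (auto simp: a0)
      have off: "qinner m (f x) (lin_ext m g (f y)) = 0"
        if "x \<in> words \<kappa>" "y \<in> words \<kappa>" "x \<noteq> y" for x y
      proof -
        have "f x z = 0 \<or> f y z = 0" for z using Bdisj[OF that(1,2)] that(3) by (auto simp: f_def)
        then show ?thesis unfolding inner0 by (intro sum.neutral) auto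
      qed
      show ?thesis
      proof (cases "b = replicate n 0")
        case True
        have "dot b z = 0" for z by (simp add: dot_def True)
        then have "?\<chi> z = 1" for z by (simp add: char_0)
        then have "qinner m (f x) (lin_ext m g (f y)) = qinner m (f x) (f y)" for x y
          unfolding inner0 by (simp add: qinner_def mult.commute)
        then show ?thesis using f_orth by (intro exI[of _ 1]) (simp add: m_def)
      next
        case False
        then obtain e where e: "e \<in> G" "dot b (take n e) \<noteq> 0" using z_dist b by blast
        \<comment> \<open>A nonzero product \<open>dot b (take n e)\<close> may still have trace 0,
          so \<open>e\<close> is replaced by a scalar multiple on which the character is not
          1.\<close>
        then obtain c where c: "\<omega> ^ trace_rep (c * dot b (take n e)) \<noteq> 1" using char_nontriv by blast
        define h where "h = map ((*) c) e"
        have h: "h \<in> G" unfolding h_def by (rule G_scale[OF e(1)])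
        have "dot b (take n h) = c * dot b (take n e)"
          using GW[OF e(1)] b(1)
          by (simp add: h_def dot_def words_def m_def sum_distrib_left mult_ac)
        then have h1: "?\<chi> h \<noteq> 1" using c by simp
        have \<chi>h: "?\<chi> (map2 (+) z h) = ?\<chi> h * ?\<chi> z" if "z \<in> words m" for z
        proof -
          have "take n (map2 (+) z h) = map2 (+) (take n z) (take n h)"
            by (simp add: take_map take_zip)
          then show ?thesis
            using that GW[OF h] b(1)
            by (subst dot_add[of _ n] | simp add: words_def m_def char_add mult.commute)+
        qed
        have diag: "(\<Sum>z\<in>words m. f x z * (?\<chi> z * cnj (f x z))) = 0" if x: "x \<in> words \<kappa>" for x
        proof -
          let ?T = "\<lambda>z. f x z * (?\<chi> z * cnj (f x z))"
          have "bij_betw (\<lambda>z. map2 (+) z h) (words m) (words m)"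
            by (rule bij_betw_byWitness[where f' = "\<lambda>z. map2 (-) z h"])
               (use GW[OF h] in \<open>auto simp: add_diff vadd_in_words vdiff_in_words\<close>)
          then have "sum ?T (words m) = (\<Sum>z\<in>words m. ?T (map2 (+) z h))"
            by (rule sum.reindex_bij_betw[symmetric])
          also have "\<dots> = (\<Sum>z\<in>words m. ?\<chi> h * ?T z)"
          proof (rule sum.cong[OF refl])
            fix z :: "'f list" assume z: "z \<in> words m"
            have "f x (map2 (+) z h) = f x z" using Bshift[OF x z h] by (simp add: f_def)
            then show "?T (map2 (+) z h) = ?\<chi> h * ?T z" by (simp add: \<chi>h[OF z])
          qed
          also have "\<dots> = ?\<chi> h * sum ?T (words m)" by (rule sum_distrib_left[symmetric])
          finally have "sum ?T (words m) = ?\<chi> h * sum ?T (words m)" .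
          moreover have "s = 0" if "s = c' * s" "c' \<noteq> 1" for s c' :: complex
            using that by (metis mult_cancel_right1)
          ultimately show ?thesis using h1 by blast
        qed
        have "\<forall>x\<in>words \<kappa>. \<forall>y\<in>words \<kappa>.
            qinner m (f x) (lin_ext m g (f y)) = (if x = y then 0 else 0)"
          using off diag inner0 by metis
        then show ?thesis by blast
      qed
    qed
    then obtain \<mu> where \<mu>: "\<And>x y. x \<in> words \<kappa> \<Longrightarrow> y \<in> words \<kappa> \<Longrightarrow>
        qinner (n + 1) (f x) (lin_ext (n + 1) g (f y)) = (if x = y then \<mu> else 0)"
      unfolding m_def by blast
    show ?thesis
      unfolding g(1) by (intro exI[of _ \<mu>] ballI orth_projector_detects[OF finite_words f_orth Q_def \<mu>])
  qed
  ultimately show ?thesis unfolding asymmetric_eaqecc_def by blast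
qed

section \<open>Characters and roots in the algebraic closure\<close>

lemma finite_field_CHAR:
  assumes "prime p" "r \<ge> 1" "CARD('f::finite_field) = p ^ r"
  shows "CHAR('f) = p"
proof -
  have "CHAR('f) dvd p ^ r" using CHAR_dvd_CARD[where 'a = 'f] assms(3) by simp
  then have "CHAR('f) dvd p" using prime_dvd_power CHAR_prime by blast
  then show ?thesis using assms(1) CHAR_prime[where 'a = 'f] primes_dvd_imp_eq by blast
qed

text \<open>The degree \<open>m ^ (n - 1)\<close> is too small for \<open>m ^ n\<close> roots. With
  all coefficients 1 this shows that the absolute trace is not identically 0; with powers of a fixed
  element as coefficients it serves the duality of the evaluation codes.\<close>

lemma linearized_poly_nonvanishing:
  fixes a :: "nat \<Rightarrow> 'a::idom"
  assumes "m > 1" "n > 0" "a (n - 1) \<noteq> 0" "finite A" "card A \<ge> m ^ n"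
  obtains x where "x \<in> A" "(\<Sum>k<n. a k * x ^ (m ^ k)) \<noteq> 0"
proof -
  define P where "P = (\<Sum>k<n. Polynomial.monom (a k) (m ^ k))"
  have P: "poly P x = (\<Sum>k<n. a k * x ^ (m ^ k))" for x
    by (simp add: P_def poly_sum poly_monom)
  have "poly.coeff P (m ^ (n - 1)) = (\<Sum>k<n. if k = n - 1 then a k else 0)"
    unfolding P_def coeff_sum using assms(1) by (intro sum.cong) (auto simp: power_inject_exp)
  then have "P \<noteq> 0" using assms(2,3) by auto
  have "Polynomial.degree P \<le> m ^ (n - 1)"
    unfolding P_def
  proof (rule degree_sum_le)
    show "Polynomial.degree (Polynomial.monom (a k) (m ^ k)) \<le> m ^ (n - 1)" if "k \<in> {..<n}" for k
      using that assms(1) degree_monom_le[of "a k" "m ^ k"] power_increasing[of k "n - 1" m]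
      by (auto intro: order_trans)
  qed auto
  then have "card {x. poly P x = 0} \<le> m ^ (n - 1)"
    using card_poly_roots_bound[OF \<open>P \<noteq> 0\<close>] by linarith
  also have "\<dots> < m ^ n" using assms(1,2) by (intro power_strict_increasing) auto
  finally have "card {x. poly P x = 0} < card A" using assms(5) by linarith
  then have "\<not> A \<subseteq> {x. poly P x = 0}"
    using card_mono[OF poly_roots_finite[OF \<open>P \<noteq> 0\<close>], of A] by linarith
  then show ?thesis using that P by auto
qed

text \<open>The polynomial \<open>x ^ p - x\<close> has at most \<open>p\<close> roots, and the
  \<open>p\<close> multiples of 1 are roots already. This makes the description operator in
  \<open>trace_rep\<close> meaningful.\<close>

lemma prime_field_char:
  fixes x :: "'f::finite_field"
  assumes "x ^ CHAR('f) = x"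
  shows "\<exists>!k. k < CHAR('f) \<and> of_nat k = x"
proof -
  let ?p = "CHAR('f)"
  let ?A = "{x :: 'f. x ^ ?p = x}"
  have p: "?p > 1" using prime_gt_1_nat CHAR_prime by blast
  have inj: "inj_on (of_nat :: nat \<Rightarrow> 'f) {..<?p}"
    by (rule inj_onI) (simp add: of_nat_eq_iff_cong_CHAR cong_less_modulus_unique_nat)
  have of_nat_pow: "of_nat k ^ ?p = (of_nat k :: 'f)" for k
  proof (induction k)
    case (Suc k)
    then show ?case by (simp add: freshmans_dream)
  qed (use p in auto)
  define P :: "'f poly" where "P = Polynomial.monom 1 ?p - Polynomial.monom 1 1"
  have "poly.coeff P ?p = 1" using p by (simp add: P_def)
  then have "P \<noteq> 0" by auto
  moreover have "{x. poly P x = 0} = ?A" by (auto simp: P_def poly_monom)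
  moreover have "Polynomial.degree P \<le> ?p"
    unfolding P_def by (rule degree_diff_le) (use p in \<open>simp_all add: degree_monom_eq\<close>)
  ultimately have "card ?A \<le> ?p" using card_poly_roots_bound[of P] by simp
  moreover have "of_nat ` {..<?p} \<subseteq> ?A" using of_nat_pow by auto
  moreover have "card ((of_nat :: nat \<Rightarrow> 'f) ` {..<?p}) = ?p" using inj by (simp add: card_image)
  ultimately have "of_nat ` {..<?p} = ?A" by (intro card_seteq) auto
  then have "x \<in> of_nat ` {..<?p}" using assms by simp
  then show ?thesis using inj by (auto dest: inj_onD)
qed

section \<open>The absolute trace and the additive characters of F_q\<close>

context
  fixes p r :: nat
  assumes p: "prime p" "r \<ge> 1" and card: "CARD('f::finite_field) = p ^ r"
begin

lemma abs_degree_eq: "abs_degree TYPE('f) = r"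
  unfolding abs_degree_def card finite_field_CHAR[OF p card]
  using prime_gt_1_nat[OF p(1)] by (simp add: power_inject_exp)

lemma field_trace_add: "field_trace (x + y :: 'f) = field_trace x + field_trace y"
proof -
  have "(x + y) ^ (CHAR('f) ^ i) = x ^ (CHAR('f) ^ i) + y ^ (CHAR('f) ^ i)" for i
    by (rule freshmans_dream'[OF CHAR_prime refl])
  then show ?thesis by (simp add: field_trace_def sum.distrib)
qed

text \<open>Frobenius permutes the summands of the trace cyclically, so the trace lies in the prime
  field.\<close>

lemma field_trace_power: "field_trace (x :: 'f) ^ CHAR('f) = field_trace x"
proof -
  let ?p = "CHAR('f)"
  have "field_trace x ^ ?p = (\<Sum>i<r. (x ^ (?p ^ i)) ^ ?p)"
    unfolding field_trace_def abs_degree_eq by (rule freshmans_dream_sum) auto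
  also have "\<dots> = (\<Sum>i<r. x ^ (?p ^ Suc i))"
    by (simp add: mult.commute flip: power_mult)
  also have "\<dots> = (\<Sum>i<r. x ^ (?p ^ i)) + x ^ (?p ^ r) - x ^ (?p ^ 0)"
    using sum.lessThan_Suc_shift[of "\<lambda>i. x ^ (?p ^ i)" r] sum.lessThan_Suc[of "\<lambda>i. x ^ (?p ^ i)" r]
    by (simp add: algebra_simps)
  also have "x ^ (?p ^ r) = x"
    using finite_field_power_card_eq_same[of x] card finite_field_CHAR[OF p card] by simp
  finally show ?thesis by (simp add: field_trace_def abs_degree_eq)
qed

lemma trace_rep:
  "trace_rep (x :: 'f) < CHAR('f)" "of_nat (trace_rep x) = field_trace x"
  using theI'[OF prime_field_char[OF field_trace_power[of x]]] by (simp_all add: trace_rep_def)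

lemma trace_rep_0: "trace_rep (0 :: 'f) = 0"
proof -
  have "field_trace (0 :: 'f) = 0" by (simp add: field_trace_def power_0_left)
  then have "of_nat (trace_rep (0 :: 'f)) = (0 :: 'f)" using trace_rep(2) by simp
  then have "CHAR('f) dvd trace_rep (0 :: 'f)" by (simp add: of_nat_eq_0_iff_char_dvd)
  then show ?thesis using trace_rep(1)[of 0] by (meson nat_dvd_not_less not_gr_zero)
qed

lemma field_trace_nontrivial: "\<exists>x :: 'f. field_trace x \<noteq> 0"
proof -
  have "CARD('f) = CHAR('f) ^ r" using card finite_field_CHAR[OF p card] by simp
  then obtain x :: 'f where "(\<Sum>k<r. 1 * x ^ (CHAR('f) ^ k)) \<noteq> 0"
    using linearized_poly_nonvanishing[of "CHAR('f)" r "\<lambda>_. 1 :: 'f" UNIV] p(2) prime_gt_1_nat[OF CHAR_prime]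
    by auto
  then show ?thesis by (auto simp: field_trace_def abs_degree_eq)
qed

lemma trace_char_add:
  assumes "\<omega> ^ p = (1 :: complex)"
  shows "\<omega> ^ trace_rep (x + y :: 'f) = \<omega> ^ trace_rep x * \<omega> ^ trace_rep y"
proof -
  have "of_nat (trace_rep (x + y)) = (of_nat (trace_rep x + trace_rep y) :: 'f)"
    by (simp add: trace_rep field_trace_add)
  then have "trace_rep (x + y) mod p = (trace_rep x + trace_rep y) mod p"
    unfolding of_nat_eq_iff_cong_CHAR unique_euclidean_semiring_class.cong_def finite_field_CHAR[OF p card] .
  moreover have "\<omega> ^ k = \<omega> ^ (k mod p)" for k
    using assms by (metis mod_mult_div_eq mult.right_neutral power_add power_mult power_one)
  ultimately show ?thesis by (metis power_add)
qed

lemma trace_char_nontrivial: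
  assumes "\<forall>k. 0 < k \<and> k < p \<longrightarrow> \<omega> ^ k \<noteq> (1 :: complex)" and "x \<noteq> (0 :: 'f)"
  shows "\<exists>c. \<omega> ^ trace_rep (c * x) \<noteq> 1"
proof -
  obtain y :: 'f where y: "field_trace y \<noteq> 0" using field_trace_nontrivial by blast
  then have "trace_rep y \<noteq> 0" using trace_rep(2)[of y] by (metis of_nat_0)
  then have "\<omega> ^ trace_rep y \<noteq> 1"
    using assms(1) trace_rep(1)[of y] finite_field_CHAR[OF p card] by simp
  moreover have "y = y / x * x" using assms(2) by simp
  ultimately show ?thesis by metis
qed

end

text \<open>The derivative of \<open>x ^ m - x\<close> is -1, so there are no multiple roots. The
  case \<open>m = N\<close> provides the evaluation points, the case \<open>m = q ^ n\<close> the
  subfield with \<open>q ^ n\<close> elements.\<close>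

lemma card_power_fixpoints_alg_closure:
  assumes "CHAR('f::field) dvd m" "m > 1"
  shows "card {x :: 'f alg_closure. x ^ m = x} = m"
proof -
  define P :: "'f alg_closure poly" where "P = Polynomial.monom 1 m - Polynomial.monom 1 1"
  have "of_nat m = (0 :: 'f alg_closure)"
    using assms(1) by (simp add: of_nat_eq_0_iff_char_dvd)
  then have d: "pderiv P = -1"
    by (simp add: P_def pderiv_diff pderiv_monom one_poly_def flip: monom_0)
  have deg: "Polynomial.degree P = m"
    unfolding P_def diff_conv_add_uminus
    using assms(2) by (subst degree_add_eq_left) (auto simp: degree_monom_eq)
  then have P0: "P \<noteq> 0" using assms(2) by auto
  have roots: "{x. poly P x = 0} = {x. x ^ m = x}" by (auto simp: P_def poly_monom)
  obtain A where A: "size A = Polynomial.degree P" "P = Polynomial.smult (Polynomial.lead_coeff P) (\<Prod>x\<in>#A. [:-x, 1:])"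
    using alg_closed_imp_factorization[OF P0] by blast
  have "count A x = 1" if "x \<in># A" for x
  proof (rule ccontr)
    assume "count A x \<noteq> 1"
    moreover have "count A x > 0" using that by simp
    ultimately have "count A x \<ge> 2" by linarith
    then have "{#x, x#} \<subseteq># A" by (simp add: subseteq_mset_def)
    then obtain B where B: "A = {#x, x#} + B" by (auto simp: mset_subset_eq_exists_conv)
    define R where "R = Polynomial.smult (Polynomial.lead_coeff P) (\<Prod>y\<in>#B. [:-y, 1:])"
    have "P = [:-x, 1:] * ([:-x, 1:] * R)"
      by (subst A(2)) (simp add: B R_def)
    then have "pderiv P = pderiv ([:-x, 1:] * ([:-x, 1:] * R))" by simp
    then have "poly (pderiv P) x = 0" by (simp only: pderiv_mult poly_add poly_mult) simp
    then show False by (simp add: d)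
  qed
  then have "size A = card (set_mset A)" by (simp add: size_multiset_overloaded_eq)
  moreover have "poly P x = 0 \<longleftrightarrow> x \<in># A" for x
    using P0 by (subst A(2)) (auto simp: poly_prod_mset prod_mset_zero_iff)
  ultimately show ?thesis using A(1) deg roots by simp
qed

section \<open>Cyclotomic sets\<close>

text \<open>Injectivity allows steps to be cancelled, so a repetition in the orbit forces a return
  to \<open>z\<close> itself; the period is then the size of the orbit.\<close>

lemma orbit_period:
  fixes f :: "'a \<Rightarrow> 'a"
  assumes A: "finite A" "inj_on f A" "f ` A \<subseteq> A" and z: "z \<in> A"
  defines "n \<equiv> card (range (\<lambda>i. (f ^^ i) z))"
  shows "n > 0" and "(f ^^ n) z = z" and "bij_betw (\<lambda>i. (f ^^ i) z) {..<n} (range (\<lambda>i. (f ^^ i) z))"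
proof -
  let ?g = "\<lambda>i. (f ^^ i) z"
  have mem: "?g i \<in> A" for i
    by (induction i) (use A(3) z in \<open>auto intro: subsetD\<close>)
  have cancel: "?g (j - i) = z" if "?g i = ?g j" "i \<le> j" for i j
    using that
  proof (induction i arbitrary: j)
    case (Suc i)
    then obtain j' where j: "j = Suc j'" by (metis Suc_le_D)
    have "?g i = ?g j'" by (rule inj_onD[OF A(2) _ mem mem]) (use Suc.prems j in simp)
    then have "?g (j' - i) = z" by (rule Suc.IH) (use Suc.prems j in simp)
    then show ?case by (simp add: j)
  next
    case 0
    show ?case using 0(1)[symmetric] by simp
  qed
  have fin: "finite (range ?g)" by (rule finite_subset[OF _ A(1)]) (simp add: image_subsetI mem)
  have "\<not> inj ?g" using fin range_inj_infinite by blast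
  then obtain i j where "i < j" "?g i = ?g j" unfolding inj_def by (metis linorder_neqE_nat)
  then have ex: "\<exists>k>0. ?g k = z" using cancel[of i j] by (intro exI[of _ "j - i"]) auto
  define m where "m = (LEAST k. k > 0 \<and> ?g k = z)"
  have m: "m > 0" "?g m = z" using LeastI_ex[OF ex] by (auto simp: m_def)
  have least: "m \<le> k" if "k > 0" "?g k = z" for k unfolding m_def using that by (intro Least_le) auto
  have inj: "inj_on ?g {..<m}"
  proof (rule linorder_inj_onI')
    fix i j assume "i \<in> {..<m}" "j \<in> {..<m}" "i < j"
    then show "?g i \<noteq> ?g j" using cancel[of i j] least[of "j - i"] by fastforce
  qed
  have img: "?g ` {..<m} = range ?g"
  proof (intro subset_antisym image_subsetI)
    fix i
    have "?g i = ?g (i mod m)" by (rule funpow_mod_eq[OF m(2), symmetric])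
    then show "?g i \<in> ?g ` {..<m}" by (rule image_eqI) (use m(1) in simp)
  qed auto
  have "n = m" unfolding n_def using inj by (simp add: card_image flip: img)
  then show "n > 0" "?g n = z" "bij_betw ?g {..<n} (range ?g)"
    using m inj img by (auto simp: bij_betw_def)
qed

lemma positive_residue_unique:
  fixes a b m :: nat
  assumes "0 < a" "a \<le> m" "0 < b" "b \<le> m" "a mod m = b mod m"
  shows "a = b"
proof -
  have "x mod m = (if x = m then 0 else x)" if "x \<le> m" for x
    using that by auto
  from this[OF assms(2)] this[OF assms(4)] have "(if a = m then 0 else a) = (if b = m then 0 else b)"
    by (simp only: assms(5))
  then show ?thesis using assms(1,3) by (simp split: if_splits)
qed

text \<open>Coprimality makes \<open>cyc_mult N q\<close> a permutation of \<open>{..<N}\<close>,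
  whose cycles are the minimal cyclotomic sets.\<close>

locale cyclotomic =
  fixes N q :: nat
  assumes N: "N > 1" and coprime: "coprime q (N - 1)"
begin

abbreviation T where "T \<equiv> cyc_mult N q"

lemma cyc_mult_0 [simp]: "cyc_mult N k 0 = 0"
  by (simp add: cyc_mult_def)

lemma cyc_mult_mod: "z > 0 \<Longrightarrow> cyc_mult N k z mod (N - 1) = k * z mod (N - 1)"
  by (simp add: cyc_mult_def)

lemma cyc_mult_pos: "z > 0 \<Longrightarrow> cyc_mult N k z > 0"
  using N by (simp add: cyc_mult_def)

lemma cyc_mult_le: "cyc_mult N k z \<le> N - 1"
  using N mod_less_divisor[of "N - 1" "k * z"] by (simp add: cyc_mult_def)

lemma cyc_mult_less: "cyc_mult N k z < N"
  using cyc_mult_le[of k z] N by linarith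

lemma cyc_mult_eqI:
  assumes "z > 0" "0 < y" "y \<le> N - 1" "y mod (N - 1) = k * z mod (N - 1)"
  shows "cyc_mult N k z = y"
  by (rule positive_residue_unique[OF cyc_mult_pos[OF assms(1)] cyc_mult_le assms(2,3)])
     (simp only: cyc_mult_mod[OF assms(1)] assms(4))

lemma funpow_T: "z < N \<Longrightarrow> (T ^^ i) z = cyc_mult N (q ^ i) z"
proof (induction i)
  case 0
  then have "cyc_mult N 1 z = z" if "z > 0" using that by (intro cyc_mult_eqI) auto
  then show ?case by (cases "z = 0") auto
next
  case (Suc i)
  show ?case
  proof (cases "z = 0")
    case False
    then have "T (cyc_mult N (q ^ i) z) = cyc_mult N (q ^ Suc i) z"
    proof (intro cyc_mult_eqI cyc_mult_pos cyc_mult_le)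
      have "q * cyc_mult N (q ^ i) z mod (N - 1) = q * (q ^ i * z mod (N - 1)) mod (N - 1)"
        using False cyc_mult_mod[of z "q ^ i"] by (metis mod_mult_right_eq not_gr_zero)
      also have "\<dots> = q ^ Suc i * z mod (N - 1)"
        unfolding mod_mult_right_eq by (simp only: power_Suc mult.assoc)
      finally show "cyc_mult N (q ^ Suc i) z mod (N - 1) = q * cyc_mult N (q ^ i) z mod (N - 1)"
        using False cyc_mult_mod[of z "q ^ Suc i"] by simp
    qed (use False in auto)
    then show ?thesis using Suc by simp
  qed (use Suc in auto)
qed

lemma inj_T: "inj_on T {..<N}"
proof (rule inj_onI)
  fix a b assume ab: "a \<in> {..<N}" "b \<in> {..<N}" "T a = T b"
  show "a = b"
  proof (cases "a = 0 \<or> b = 0")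
    case True
    then show ?thesis using ab(3) cyc_mult_pos by (metis cyc_mult_0 not_gr_zero)
  next
    case False
    then have "q * a mod (N - 1) = q * b mod (N - 1)"
      using ab(3) cyc_mult_mod[of a q] cyc_mult_mod[of b q] by simp
    then have "[q * a = q * b] (mod (N - 1))" by (simp only: unique_euclidean_semiring_class.cong_def)
    then have "[a = b] (mod (N - 1))" by (simp only: cong_mult_lcancel_nat[OF coprime])
    then have "a mod (N - 1) = b mod (N - 1)" by (simp only: unique_euclidean_semiring_class.cong_def)
    then show ?thesis
      by (rule positive_residue_unique[rotated 4]) (use ab False in auto)
  qed
qed

lemma T_image: "T ` {..<N} \<subseteq> {..<N}"
  using cyc_mult_less by auto

lemma bij_T: "bij_betw T {..<N} {..<N}"
  using inj_T endo_inj_surj[OF _ T_image inj_T] by (simp add: bij_betw_def)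

lemma min_cyc_eq: "z < N \<Longrightarrow> min_cyc N q z = range (\<lambda>i. (T ^^ i) z)"
  by (auto simp: min_cyc_def funpow_T)

lemma period:
  assumes "z < N"
  shows "card (min_cyc N q z) > 0" and "(T ^^ card (min_cyc N q z)) z = z"
    and "bij_betw (\<lambda>i. (T ^^ i) z) {..<card (min_cyc N q z)} (min_cyc N q z)"
  using orbit_period[of "{..<N}" T z] inj_T T_image assms by (simp_all add: min_cyc_eq)

lemma min_cyc_subset: "min_cyc N q z \<subseteq> {..<N}"
  by (auto simp: min_cyc_def cyc_mult_less)

lemma finite_min_cyc: "finite (min_cyc N q z)"
  using min_cyc_subset finite_subset by blast

lemma funpow_mem_min_cyc: "z < N \<Longrightarrow> (T ^^ i) z \<in> min_cyc N q z"
  by (simp add: min_cyc_eq)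

lemma self_mem_min_cyc: "z < N \<Longrightarrow> z \<in> min_cyc N q z"
  using funpow_mem_min_cyc[of z 0] by simp

lemma min_cyc_closed:
  assumes "z < N" "x \<in> min_cyc N q z"
  shows "T x \<in> min_cyc N q z"
proof -
  obtain i where "x = (T ^^ i) z" using assms by (auto simp: min_cyc_eq)
  then have "T x = (T ^^ Suc i) z" by simp
  then show ?thesis using funpow_mem_min_cyc[OF assms(1), of "Suc i"] by (simp only:)
qed

lemma closed_funpow: "T ` D \<subseteq> D \<Longrightarrow> x \<in> D \<Longrightarrow> (T ^^ i) x \<in> D"
  by (induction i) auto

lemma min_cyc_subset_closed: "T ` D \<subseteq> D \<Longrightarrow> x \<in> D \<Longrightarrow> x < N \<Longrightarrow> min_cyc N q x \<subseteq> D"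
  using closed_funpow by (auto simp: min_cyc_eq)

text \<open>On a cycle the inverse of \<open>T\<close> is a power of \<open>T\<close>, so a closed
  set contains preimages too.\<close>

lemma closed_cancel:
  assumes "T ` D \<subseteq> D" "x < N" "T x \<in> D"
  shows "x \<in> D"
proof -
  have "(T ^^ (card (min_cyc N q x) - 1)) (T x) = (T ^^ Suc (card (min_cyc N q x) - 1)) x"
    by (simp add: funpow_swap1)
  also have "\<dots> = x" using period(1,2)[OF assms(2)] by simp
  finally have "(T ^^ (card (min_cyc N q x) - 1)) (T x) = x" .
  with closed_funpow[OF assms(1,3), of "card (min_cyc N q x) - 1"] show ?thesis by (simp only:)
qed

lemma min_cyc_eq_of_mem:
  assumes "z < N" "x \<in> min_cyc N q z"
  shows "min_cyc N q x = min_cyc N q z"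
proof
  have x: "x < N" using assms min_cyc_subset by auto
  have cl: "T ` min_cyc N q y \<subseteq> min_cyc N q y" if "y < N" for y using min_cyc_closed that by auto
  show "min_cyc N q x \<subseteq> min_cyc N q z" using min_cyc_subset_closed cl assms x by blast
  have "z \<in> min_cyc N q x"
  proof -
    obtain i where i: "x = (T ^^ i) z" using assms by (auto simp: min_cyc_eq)
    have down: "(T ^^ k) z \<in> min_cyc N q x \<Longrightarrow> z \<in> min_cyc N q x" for k
    proof (induction k)
      case (Suc k)
      have "(T ^^ k) z < N" using funpow_mem_min_cyc[OF assms(1)] min_cyc_subset by blast
      then show ?case using Suc closed_cancel[OF cl[OF x]] by simp
    qed auto
    show ?thesis by (rule down[of i]) (use self_mem_min_cyc[OF x] in \<open>simp only: i[symmetric]\<close>)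
  qed
  then show "min_cyc N q z \<subseteq> min_cyc N q x" using min_cyc_subset_closed cl assms x by blast
qed

lemma max_reps_iff: "b \<in> max_reps N q \<longleftrightarrow> b < N \<and> Max (min_cyc N q b) = b"
proof
  assume "b \<in> max_reps N q"
  then obtain z where z: "z < N" "b = Max (min_cyc N q z)" by (auto simp: max_reps_def)
  then have b: "b \<in> min_cyc N q z"
    using Max_in[OF finite_min_cyc] self_mem_min_cyc by blast
  then show "b < N \<and> Max (min_cyc N q b) = b"
    using min_cyc_eq_of_mem[OF z(1) b] z min_cyc_subset by auto
next
  assume b: "b < N \<and> Max (min_cyc N q b) = b"
  then have "b = Max (min_cyc N q b)" by simp
  then show "b \<in> max_reps N q" unfolding max_reps_def using b by blast
qed

lemma cyc_part_eq: "cyc_part N q \<Gamma> = {z. z < N \<and> min_cyc N q z \<subseteq> \<Gamma>}"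
proof (intro subset_antisym subsetI)
  fix x assume "x \<in> cyc_part N q \<Gamma>"
  then obtain z where "z < N" "min_cyc N q z \<subseteq> \<Gamma>" "x \<in> min_cyc N q z" by (auto simp: cyc_part_def)
  then show "x \<in> {z. z < N \<and> min_cyc N q z \<subseteq> \<Gamma>}"
    using min_cyc_eq_of_mem[of z x] min_cyc_subset by auto
qed (use self_mem_min_cyc in \<open>auto simp: cyc_part_def\<close>)

lemma cyc_part_subset: "cyc_part N q \<Gamma> \<subseteq> \<Gamma>"
  using self_mem_min_cyc by (auto simp: cyc_part_eq)

lemma cyc_part_closed: "T ` cyc_part N q \<Gamma> \<subseteq> cyc_part N q \<Gamma>"
proof (rule image_subsetI)
  fix x assume x: "x \<in> cyc_part N q \<Gamma>"
  then have "x < N" by (simp add: cyc_part_eq)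
  then have "min_cyc N q (T x) = min_cyc N q x"
    by (intro min_cyc_eq_of_mem min_cyc_closed self_mem_min_cyc)
  then show "T x \<in> cyc_part N q \<Gamma>" using x by (simp add: cyc_part_eq cyc_mult_less)
qed

text \<open>A minimal cyclotomic set lies below \<open>d\<close> exactly if its maximum does, and
  distinct maxima belong to disjoint sets.\<close>

lemma card_cyc_part_below:
  "card (cyc_part N q ({0..d} - {d})) = (\<Sum>b\<in>{b \<in> max_reps N q. b < d}. card (min_cyc N q b))"
proof -
  have "{0..d} - {d} = {..<d}" by auto
  moreover have "cyc_part N q {..<d} = (\<Union>b\<in>{b \<in> max_reps N q. b < d}. min_cyc N q b)"
  proof (intro subset_antisym subsetI)
    fix x assume x: "x \<in> cyc_part N q {..<d}"
    define b where "b = Max (min_cyc N q x)"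
    have x': "x < N" "min_cyc N q x \<subseteq> {..<d}" using x by (auto simp: cyc_part_eq)
    have self: "x \<in> min_cyc N q x" by (rule self_mem_min_cyc[OF x'(1)])
    have b: "b \<in> min_cyc N q x"
      unfolding b_def using Max_in[OF finite_min_cyc] self by blast
    have "b < d" using b x'(2) by auto
    moreover have "x \<in> min_cyc N q b" unfolding min_cyc_eq_of_mem[OF x'(1) b] by (rule self)
    moreover have "b \<in> max_reps N q" unfolding max_reps_def b_def using x'(1) by blast
    ultimately show "x \<in> (\<Union>b\<in>{b \<in> max_reps N q. b < d}. min_cyc N q b)" by blast
  next
    fix x assume "x \<in> (\<Union>b\<in>{b \<in> max_reps N q. b < d}. min_cyc N q b)"
    then obtain b where b: "b < N" "Max (min_cyc N q b) = b" "b < d" "x \<in> min_cyc N q b"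
      by (auto simp: max_reps_iff)
    have "y < d" if "y \<in> min_cyc N q b" for y
      using Max_ge[OF finite_min_cyc that] b(2,3) by linarith
    moreover have "x < N" using b(4) min_cyc_subset by blast
    ultimately show "x \<in> cyc_part N q {..<d}"
      unfolding cyc_part_eq mem_Collect_eq min_cyc_eq_of_mem[OF b(1,4)] by blast
  qed
  moreover have "card (\<Union>b\<in>{b \<in> max_reps N q. b < d}. min_cyc N q b)
      = (\<Sum>b\<in>{b \<in> max_reps N q. b < d}. card (min_cyc N q b))"
  proof (rule card_UN_disjoint)
    show "\<forall>i\<in>{b \<in> max_reps N q. b < d}. \<forall>j\<in>{b \<in> max_reps N q. b < d}. i \<noteq> j \<longrightarrow> min_cyc N q i \<inter> min_cyc N q j = {}"
    proof (intro ballI impI equals0I)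
      fix i j x assume "i \<in> {b \<in> max_reps N q. b < d}" "j \<in> {b \<in> max_reps N q. b < d}" "i \<noteq> j"
        "x \<in> min_cyc N q i \<inter> min_cyc N q j"
      then have ij: "i < N" "Max (min_cyc N q i) = i" "j < N" "Max (min_cyc N q j) = j" "i \<noteq> j"
        "x \<in> min_cyc N q i" "x \<in> min_cyc N q j"
        by (auto simp: max_reps_iff)
      then have "min_cyc N q i = min_cyc N q j"
        using min_cyc_eq_of_mem[OF ij(1,6)] min_cyc_eq_of_mem[OF ij(3,7)] by (simp only:)
      then show False using ij(2,4,5) by metis
    qed
  next
    have "{b \<in> max_reps N q. b < d} \<subseteq> {..<d}" by blast
    then show "finite {b \<in> max_reps N q. b < d}" by (rule finite_subset) simp
  qed (simp add: finite_min_cyc)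
  ultimately show ?thesis by (simp only:)
qed

section \<open>Reflection of exponents and the set \<open>perp\<close>\<close>

context
  fixes D :: "nat set"
  assumes D: "D \<subseteq> {..<N}"
begin

lemma mem_perp_iff: "\<alpha> \<in> perp N D \<longleftrightarrow> \<alpha> < N \<and> N - 1 - \<alpha> \<notin> D"
proof -
  have "(\<forall>h\<in>D. \<alpha> \<noteq> N - 1 - h) \<longleftrightarrow> N - 1 - \<alpha> \<notin> D" if "\<alpha> < N"
  proof -
    have "\<alpha> = N - 1 - h \<longleftrightarrow> h = N - 1 - \<alpha>" if "h \<in> D" for h
      using that D \<open>\<alpha> < N\<close> by force
    then show ?thesis by auto
  qed
  then show ?thesis by (auto simp: perp_def)
qed

lemma card_perp: "card (perp N D) = N - card D"
proof -
  have "perp N D = (\<lambda>h. N - 1 - h) ` ({..<N} - D)"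
  proof (intro subset_antisym subsetI)
    fix \<alpha> assume "\<alpha> \<in> perp N D"
    then have "\<alpha> < N" "N - 1 - \<alpha> \<notin> D" by (auto simp: mem_perp_iff)
    then show "\<alpha> \<in> (\<lambda>h. N - 1 - h) ` ({..<N} - D)"
      by (intro image_eqI[of _ _ "N - 1 - \<alpha>"]) auto
  qed (use N in \<open>auto simp: mem_perp_iff\<close>)
  moreover have "inj_on (\<lambda>h. N - 1 - h) ({..<N} - D)"
    by (rule inj_onI) auto
  ultimately show ?thesis using D by (simp add: card_image card_Diff_subset finite_subset)
qed

end

text \<open>Reflection is negation modulo \<open>N - 1\<close>, which commutes with multiplication
  by \<open>q\<close>. The ends are left out because 0 and \<open>N - 1\<close> are the same residue
  and residues cannot tell them apart.\<close>

lemma T_reflect: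
  assumes "0 < a" "a < N - 1"
  shows "T a < N - 1" and "T (N - 1 - a) = N - 1 - T a"
proof -
  have top: "T (N - 1) = N - 1" using N by (intro cyc_mult_eqI) auto
  have "a < N" "N - 1 < N" "a \<noteq> N - 1" using assms by linarith+
  then have "T a \<noteq> T (N - 1)" using inj_onD[OF inj_T, of a "N - 1"] by blast
  then show less: "T a < N - 1" using top cyc_mult_le[of q a] by linarith
  show "T (N - 1 - a) = N - 1 - T a"
  proof (rule cyc_mult_eqI)
    have "(N - 1 - T a) + T a = N - 1" "(N - 1 - a) + a = N - 1" using assms less by linarith+
    then have "[(N - 1 - T a) + T a = q * (N - 1 - a) + q * a] (mod (N - 1))"
      by (simp only: unique_euclidean_semiring_class.cong_def distrib_left[symmetric] mod_self mod_mult_self2_is_0)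
    also have "[q * (N - 1 - a) + q * a = q * (N - 1 - a) + T a] (mod (N - 1))"
    proof (intro cong_add cong_refl)
      show "[q * a = T a] (mod (N - 1))"
        using cyc_mult_mod[OF assms(1), of q] by (simp only: unique_euclidean_semiring_class.cong_def)
    qed
    finally have "[N - 1 - T a = q * (N - 1 - a)] (mod (N - 1))"
      by (simp only: cong_add_rcancel_nat)
    then show "(N - 1 - T a) mod (N - 1) = q * (N - 1 - a) mod (N - 1)" by (simp add: unique_euclidean_semiring_class.cong_def)
  qed (use assms less cyc_mult_pos[of a q] in auto)
qed

lemma perp_closed:
  assumes D: "D \<subseteq> {..<N}" "T ` D \<subseteq> D" "0 \<in> D" "N - 1 \<notin> D"
  shows "T ` perp N D \<subseteq> perp N D"
proof (rule image_subsetI)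
  fix a assume a: "a \<in> perp N D"
  then have a': "a < N" "N - 1 - a \<notin> D" by (auto simp: mem_perp_iff[OF D(1)])
  have "a \<noteq> N - 1" using a' D(3) by auto
  show "T a \<in> perp N D"
  proof (cases "a = 0")
    case True
    then show ?thesis using a by simp
  next
    case False
    then have r: "T (N - 1 - a) = N - 1 - T a" using a' \<open>a \<noteq> N - 1\<close> by (intro T_reflect) auto
    have "T (N - 1 - a) \<notin> D"
      using closed_cancel[OF D(2), of "N - 1 - a"] a' N by auto
    then have "N - 1 - T a \<notin> D" unfolding r .
    then show ?thesis by (simp only: mem_perp_iff[OF D(1)] cyc_mult_less simp_thms)
  qed
qed

end

section \<open>Evaluation codes\<close>

lemma card_poly_zeros_less:
  fixes c :: "nat \<Rightarrow> 'a::idom"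
  assumes "i0 < e" "c i0 \<noteq> 0" "inj_on x J"
  shows "card {j \<in> J. (\<Sum>i<e. c i * x j ^ i) = 0} < e"
proof -
  define P where "P = (\<Sum>i<e. Polynomial.monom (c i) i)"
  have P: "poly P y = (\<Sum>i<e. c i * y ^ i)" for y
    by (simp add: P_def poly_sum poly_monom)
  have "poly.coeff P i0 = c i0" using assms(1) by (simp add: P_def coeff_sum)
  then have "P \<noteq> 0" using assms(2) by auto
  have "Polynomial.degree P \<le> e - 1"
    unfolding P_def
  proof (rule degree_sum_le)
    show "Polynomial.degree (Polynomial.monom (c i) i) \<le> e - 1" if "i \<in> {..<e}" for i
      using that degree_monom_le[of "c i" i] by (auto intro: order_trans)
  qed auto
  then have *: "card {y. poly P y = 0} < e"
    using card_poly_roots_bound[OF \<open>P \<noteq> 0\<close>] assms(1) by linarith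
  let ?Z = "{j \<in> J. (\<Sum>i<e. c i * x j ^ i) = 0}"
  have img: "x ` ?Z \<subseteq> {y. poly P y = 0}" by (auto simp: P)
  have inj: "inj_on x ?Z" using assms(3) by (rule inj_on_subset) auto
  have fin: "finite {y. poly P y = 0}" by (rule poly_roots_finite[OF \<open>P \<noteq> 0\<close>])
  show "card ?Z < e"
    using card_image[OF inj] card_mono[OF fin img] * by linarith
qed

text \<open>Words over \<open>'f\<close> meet the points through the embedding \<open>to_ac\<close>
  into the algebraic closure, whose range is cut out by \<open>x ^ q = x\<close>. Being F_q-valued
  thus becomes invariance under Frobenius.\<close>

locale evaluation_code = cyclotomic N q
  for N q :: nat +
  fixes pts :: "nat \<Rightarrow> 'f::finite_field alg_closure" and r :: nat
  assumes q: "q = CHAR('f) ^ r" "r \<ge> 1" "CARD('f) = q"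
    and N_char: "CHAR('f) dvd N"
    and pts: "bij_betw pts {..<N} {x. x ^ N = x}"
begin

lemma q_gt_1: "q > 1"
  using q(1,2) prime_gt_1_nat[OF CHAR_prime[where 'a = 'f]] by (metis one_less_power less_le_trans zero_less_one)

lemma frob_add: "(x + y :: 'f alg_closure) ^ q = x ^ q + y ^ q"
  by (rule freshmans_dream'[of _ r]) (simp_all add: q)

lemma frob_diff: "(x - y :: 'f alg_closure) ^ q = x ^ q - y ^ q"
  using frob_add[of "x - y" y] by (simp add: algebra_simps)

lemma frob_sum: "(\<Sum>i\<in>I. f i :: 'f alg_closure) ^ q = (\<Sum>i\<in>I. f i ^ q)"
  by (rule freshmans_dream_sum'[of _ r]) (simp_all add: q)

lemma to_ac_frob: "to_ac (x :: 'f) ^ q = to_ac x"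
  using finite_field_power_card_eq_same[of x] q(3) by (metis to_ac_power)

lemma card_frob_fixpoints:
  assumes "n > 0"
  shows "card {x :: 'f alg_closure. x ^ (q ^ n) = x} = q ^ n"
proof (rule card_power_fixpoints_alg_closure)
  show "q ^ n > 1" using q_gt_1 assms by (rule one_less_power)
  have "CHAR('f) dvd q" using q(1,2) by simp
  then show "CHAR('f) dvd q ^ n" using assms by (meson dvd_power dvd_trans)
qed

lemma range_to_ac: "range (to_ac :: 'f \<Rightarrow> 'f alg_closure) = {x. x ^ q = x}"
proof (rule card_subset_eq)
  have c: "card {x :: 'f alg_closure. x ^ q = x} = q"
    using card_frob_fixpoints[of 1] by simp
  then show "finite {x :: 'f alg_closure. x ^ q = x}" using q_gt_1 by (metis card.infinite not_one_less_zero)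
  show "card (range (to_ac :: 'f \<Rightarrow> 'f alg_closure)) = card {x :: 'f alg_closure. x ^ q = x}"
    unfolding c using card_image[OF inj_to_ac[where 'a = 'f]] q(3) by simp
qed (auto simp: to_ac_frob)

lemma pts_N: "j < N \<Longrightarrow> pts j ^ N = pts j"
  using pts by (auto simp: bij_betw_def)

lemma inj_pts: "inj_on pts {..<N}"
  using pts by (simp add: bij_betw_def)

text \<open>Both exponents must be positive because 0 is one of the points: there
  \<open>x ^ 0\<close> and \<open>x ^ (N - 1)\<close> differ. This is why 0 and \<open>N - 1\<close>
  are distinct exponents.\<close>

lemma power_mod_cong:
  fixes x :: "'f alg_closure"
  assumes "x ^ N = x" "a > 0" "b > 0" "a mod (N - 1) = b mod (N - 1)"
  shows "x ^ a = x ^ b"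
proof -
  have step: "x ^ (a + k * (N - 1)) = x ^ a" if "a > 0" for a k
  proof (induction k)
    case (Suc k)
    have "a + Suc k * (N - 1) = (a + k * (N - 1) - 1) + N"
      using that N mult_Suc[of k "N - 1"] by linarith
    then have "x ^ (a + Suc k * (N - 1)) = x ^ (a + k * (N - 1) - 1) * x"
      by (simp only: power_add assms(1))
    also have "\<dots> = x ^ Suc (a + k * (N - 1) - 1)" by (simp only: power_Suc mult.commute)
    also have "Suc (a + k * (N - 1) - 1) = a + k * (N - 1)" using that by simp
    finally show ?case using Suc by simp
  qed simp
  have ordered: "x ^ a = x ^ b" if "a \<le> b" "a > 0" "a mod (N - 1) = b mod (N - 1)" for a b
  proof -
    have "(N - 1) dvd (b - a)" by (rule mod_eq_dvd_iff_nat[OF that(1), THEN iffD1]) (rule that(3)[symmetric])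
    then obtain k where "b - a = k * (N - 1)" unfolding dvd_def by (metis mult.commute)
    then have "b = a + k * (N - 1)" using that(1) by linarith
    then show ?thesis using step[OF that(2), of k] by (simp only:)
  qed
  show ?thesis
  proof (cases "a \<le> b")
    case True
    then show ?thesis by (rule ordered) (rule assms)+
  next
    case False
    then have "b \<le> a" by simp
    then show ?thesis by (rule ordered[symmetric]) (simp_all only: assms)
  qed
qed

lemma power_T:
  fixes x :: "'f alg_closure"
  assumes "x ^ N = x"
  shows "x ^ T i = (x ^ i) ^ q"
proof (cases "i = 0")
  case False
  then have "x ^ T i = x ^ (q * i)"
    using q_gt_1 by (intro power_mod_cong[OF assms] cyc_mult_pos cyc_mult_mod) auto
  then show ?thesis by (simp only: power_mult mult.commute[of q])
qed simp

lemma funpow_frob: "((\<lambda>x :: 'f alg_closure. x ^ q) ^^ k) x = x ^ (q ^ k)"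
  by (induction k) (simp_all add: mult.commute flip: power_mult)

text \<open>
  The polynomials \<open>\<delta>\<^sub>i\<^sub>0 - x\<^sup>N\<^sup>-\<^sup>1\<^sup>-\<^sup>i\<close> are dual to the monomials \<open>x\<^sup>i\<close> for the pairing
  \<open>(f, g) \<mapsto> \<Sum>\<^sub>j f(x\<^sub>j) g(x\<^sub>j)\<close>, so \<open>cf w i\<close> is the \<open>i\<close>-th coefficient of the polynomial of degree
  less than \<open>N\<close> that interpolates \<open>w\<close>.
\<close>

definition dual_monom :: "nat \<Rightarrow> 'f alg_closure \<Rightarrow> 'f alg_closure" where
  "dual_monom i x = of_bool (i = 0) - x ^ (N - 1 - i)"

definition cf :: "'f list \<Rightarrow> nat \<Rightarrow> 'f alg_closure" where
  "cf w i = (\<Sum>j<N. to_ac (w ! j) * dual_monom i (pts j))"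

text \<open>\<open>K\<close> is the difference quotient of \<open>x ^ N\<close>. Off the diagonal it
  is 1, since both arguments are fixed by the \<open>N\<close>-th power; on the diagonal it is
  \<open>N * x ^ (N - 1)\<close>, which vanishes in characteristic \<open>p\<close>.\<close>

lemma dual_monom_kernel:
  assumes "x ^ N = x" "y ^ N = y"
  shows "(\<Sum>i<N. dual_monom i y * x ^ i) = of_bool (x = y)"
proof -
  define K where "K = (\<Sum>i<N. y ^ (N - 1 - i) * x ^ i)"
  have "(\<Sum>i<N. dual_monom i y * x ^ i)
      = (\<Sum>i<N. if i = 0 then 1 else 0) - K"
    unfolding K_def dual_monom_def sum_subtractf[symmetric] by (intro sum.cong) (auto simp: algebra_simps)
  also have "\<dots> = 1 - K" using N by simp
  also have "\<dots> = of_bool (x = y)"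
  proof (cases "x = y")
    case True
    have "y ^ (N - 1 - i) * x ^ i = x ^ (N - 1)" if "i < N" for i
      using that True by (simp flip: power_add)
    then have "K = of_nat N * x ^ (N - 1)" unfolding K_def by simp
    also have "of_nat N = (0 :: 'f alg_closure)" using N_char by (simp add: of_nat_eq_0_iff_char_dvd)
    finally show ?thesis using True by simp
  next
    case False
    have "x ^ N - y ^ N = (x - y) * K"
      using power_diff_sumr2[of x N y] by (simp add: K_def)
    then show ?thesis using False assms by simp
  qed
  finally show ?thesis .
qed

lemma interpolation:
  assumes "j < N"
  shows "(\<Sum>i<N. cf w i * pts j ^ i) = to_ac (w ! j)"
proof -
  have "(\<Sum>i<N. cf w i * pts j ^ i) = (\<Sum>k<N. to_ac (w ! k) * (\<Sum>i<N. dual_monom i (pts k) * pts j ^ i))"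
    unfolding cf_def sum_distrib_left sum_distrib_right by (subst sum.swap) (simp only: mult.assoc)
  also have "\<dots> = (\<Sum>k<N. if k = j then to_ac (w ! j) else 0)"
    using assms inj_pts by (intro sum.cong) (auto simp: dual_monom_kernel pts_N dest: inj_onD)
  finally show ?thesis using assms by simp
qed

lemma cf_unique:
  assumes "\<And>j. j < N \<Longrightarrow> to_ac (w ! j) = (\<Sum>i<N. c i * pts j ^ i)" and "i < N"
  shows "cf w i = c i"
proof (rule ccontr)
  assume "cf w i \<noteq> c i"
  then have "card {j \<in> {..<N}. (\<Sum>i<N. (cf w i - c i) * pts j ^ i) = 0} < N"
    using card_poly_zeros_less[OF assms(2) _ inj_pts, of "\<lambda>i. cf w i - c i"] by simp
  moreover have "(\<Sum>i<N. (cf w i - c i) * pts j ^ i) = 0" if "j < N" for j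
    using interpolation[OF that, of w] assms(1)[OF that] by (simp add: left_diff_distrib sum_subtractf)
  then have "{j \<in> {..<N}. (\<Sum>i<N. (cf w i - c i) * pts j ^ i) = 0} = {..<N}" by auto
  ultimately show False by simp
qed

lemma cf_eq_imp_eq:
  assumes "w \<in> words N" "w' \<in> words N" "\<And>i. i < N \<Longrightarrow> cf w i = cf w' i"
  shows "w = w'"
proof (rule nth_equalityI)
  fix j assume "j < length w"
  then have j: "j < N" using assms(1) by (simp add: words_def)
  have "to_ac (w ! j) = to_ac (w' ! j)"
    using interpolation[OF j, of w] interpolation[OF j, of w'] assms(3) by simp
  then show "w ! j = w' ! j" by simp
qed (use assms in \<open>simp add: words_def\<close>)

lemma cf_scale: "w \<in> words N \<Longrightarrow> cf (map ((*) c) w) i = to_ac c * cf w i"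
  by (simp add: cf_def words_def sum_distrib_left mult.assoc)

lemma cf_diff:
  "w \<in> words N \<Longrightarrow> w' \<in> words N \<Longrightarrow> cf (map2 (-) w w') i = cf w i - cf w' i"
  by (simp add: cf_def words_def algebra_simps flip: sum_subtractf)

text \<open>Frobenius fixes the entries of \<open>w\<close> and carries the dual of
  \<open>x ^ i\<close> to the dual of \<open>x ^ T i\<close>.\<close>

lemma cf_T:
  assumes "i < N"
  shows "cf w (T i) = cf w i ^ q"
proof -
  have "dual_monom (T i) (pts j) = dual_monom i (pts j) ^ q" if j: "j < N" for j
  proof -
    note x = pts_N[OF j]
    have "pts j ^ (N - 1 - T i) = (pts j ^ (N - 1 - i)) ^ q"
    \<comment> \<open>The two ends are fixed by \<open>T\<close> and are checked by hand, since
      \<open>T_reflect\<close> covers only the exponents strictly between them.\<close>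
    proof (cases "i = 0 \<or> i = N - 1")
      case True
      have top: "T (N - 1) = N - 1" using N by (intro cyc_mult_eqI) auto
      from True show ?thesis
      proof
        assume "i = 0"
        then show ?thesis using power_T[OF x, of "N - 1"] by (simp only: top cyc_mult_0 minus_nat.diff_0)
      next
        assume "i = N - 1"
        then show ?thesis by (simp only: top diff_self_eq_0 power_0 power_one)
      qed
    next
      case False
      then have "T (N - 1 - i) = N - 1 - T i" using assms by (intro T_reflect) auto
      then show ?thesis using power_T[OF x, of "N - 1 - i"] by simp
    qed
    moreover have "T i = 0 \<longleftrightarrow> i = 0" using cyc_mult_pos[of i q] by (cases "i = 0") auto
    moreover have "of_bool (i = 0) ^ q = (of_bool (i = 0) :: 'f alg_closure)" using q_gt_1 by simp
    ultimately show ?thesis by (simp only: dual_monom_def frob_diff)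
  qed
  then show ?thesis
    by (simp add: cf_def frob_sum power_mult_distrib to_ac_frob)
qed

text \<open>A subfield subcode: the words over F_q among the evaluations of polynomials over the
  closure with exponents in \<open>D\<close>.\<close>

definition code :: "nat set \<Rightarrow> 'f list set" where
  "code D = {w \<in> words N. \<forall>i<N. i \<notin> D \<longrightarrow> cf w i = 0}"

text \<open>The coefficient vectors of the polynomials that agree with their own \<open>q\<close>-th
  power at every point.\<close>

definition frob_coeffs :: "nat set \<Rightarrow> (nat \<Rightarrow> 'f alg_closure) set" where
  "frob_coeffs D = {c. (\<forall>i<N. c (T i) = c i ^ q) \<and> (\<forall>i. i \<notin> D \<longrightarrow> c i = 0)}"

lemma code_words: "w \<in> code D \<Longrightarrow> w \<in> words N"
  by (simp add: code_def)

lemma code_mono: "D \<subseteq> E \<Longrightarrow> code D \<subseteq> code E"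
  by (auto simp: code_def)

lemma code_scale: "w \<in> code D \<Longrightarrow> map ((*) c) w \<in> code D"
  by (auto simp: code_def cf_scale) (simp add: words_def)

lemma code_diff: "w \<in> code D \<Longrightarrow> w' \<in> code D \<Longrightarrow> map2 (-) w w' \<in> code D"
  by (auto simp: code_def cf_diff) (simp add: words_def)

text \<open>Raising the value at a point to the power \<open>q\<close> only permutes the summands by
  \<open>T\<close>, so the value is fixed by Frobenius and comes from F_q.\<close>

lemma word_of_coeffs:
  assumes "c \<in> frob_coeffs D"
  obtains w where "w \<in> words N" "\<And>j. j < N \<Longrightarrow> to_ac (w ! j) = (\<Sum>i<N. c i * pts j ^ i)"
    "\<And>i. i < N \<Longrightarrow> cf w i = c i"
proof -
  define v where "v j = (\<Sum>i<N. c i * pts j ^ i)" for j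
  have "v j \<in> range to_ac" if j: "j < N" for j
  proof -
    have "v j ^ q = (\<Sum>i<N. c (T i) * pts j ^ T i)"
      unfolding v_def frob_sum using assms
      by (intro sum.cong) (auto simp: frob_coeffs_def power_mult_distrib power_T[OF pts_N[OF j]])
    also have "\<dots> = v j"
      unfolding v_def by (rule sum.reindex_bij_betw[OF bij_T])
    finally show ?thesis unfolding range_to_ac by simp
  qed
  then have v: "to_ac (of_ac (v j)) = v j" if "j < N" for j using that to_ac_of_ac by blast
  let ?w = "map (\<lambda>j. of_ac (v j)) [0..<N]"
  have w: "to_ac (?w ! j) = (\<Sum>i<N. c i * pts j ^ i)" if "j < N" for j
    using that v[OF that] by (simp add: v_def)
  show ?thesis
  proof (rule that)
    show "cf ?w i = c i" if "i < N" for i by (rule cf_unique[OF w that])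
  qed (use w in \<open>auto simp: words_def\<close>)
qed

lemma frob_coeffs_funpow:
  assumes "c \<in> frob_coeffs D" "b < N"
  shows "c ((T ^^ k) b) = c b ^ (q ^ k)"
proof (induction k)
  case (Suc k)
  have "(T ^^ k) b < N" using funpow_mem_min_cyc[OF assms(2)] min_cyc_subset by blast
  then have "c (T ((T ^^ k) b)) = c ((T ^^ k) b) ^ q" using assms(1) by (simp add: frob_coeffs_def)
  also have "\<dots> = c b ^ (q ^ Suc k)" by (simp add: Suc mult.commute flip: power_mult)
  finally show ?case by simp
qed simp

text \<open>On a cycle of length \<open>n\<close> one coefficient determines the others, and going
  round once imposes only that it lie in the field with \<open>q ^ n\<close> elements.\<close>

lemma orbit_frob_coeffs:
  assumes b: "b < N" and \<xi>: "\<xi> ^ (q ^ card (min_cyc N q b)) = \<xi>"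
  obtains c where "c \<in> frob_coeffs (min_cyc N q b)" "\<And>k. c ((T ^^ k) b) = \<xi> ^ (q ^ k)"
proof -
  define n where "n = card (min_cyc N q b)"
  note per = period[OF b, folded n_def]
  define k where "k i = (SOME k. (T ^^ k) b = i)" for i
  define c where "c i = (if i \<in> min_cyc N q b then \<xi> ^ (q ^ k i) else 0)" for i
  \<comment> \<open>Makes the choice of \<open>k i\<close> immaterial: both the exponent and the
    power of \<xi> depend only on the number of steps modulo \<open>n\<close>.\<close>
  have kk: "\<xi> ^ (q ^ l) = \<xi> ^ (q ^ l')" if "(T ^^ l) b = (T ^^ l') b" for l l'
  proof -
    have "(T ^^ (l mod n)) b = (T ^^ (l' mod n)) b"
      using that by (simp add: funpow_mod_eq[OF per(2)])
    then have m: "l mod n = l' mod n"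
      by (rule inj_onD[OF bij_betw_imp_inj_on[OF per(3)]]) (use per(1) in auto)
    have fr: "((\<lambda>x. x ^ q) ^^ n) \<xi> = \<xi>" using \<xi> by (simp add: funpow_frob n_def)
    have "\<xi> ^ (q ^ l) = \<xi> ^ (q ^ (l mod n))" for l
      using funpow_mod_eq[OF fr, of l] by (simp add: funpow_frob)
    then show ?thesis using m by metis
  qed
  have c: "c ((T ^^ l) b) = \<xi> ^ (q ^ l)" for l
  proof -
    have "(T ^^ k ((T ^^ l) b)) b = (T ^^ l) b" unfolding k_def by (rule someI[of _ l]) simp
    from kk[OF this] show ?thesis by (simp add: c_def funpow_mem_min_cyc[OF b])
  qed
  moreover have "c \<in> frob_coeffs (min_cyc N q b)"
    unfolding frob_coeffs_def
  proof (intro CollectI conjI allI impI)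
    fix i assume i: "i < N"
    show "c (T i) = c i ^ q"
    proof (cases "i \<in> min_cyc N q b")
      case True
      then obtain l where l: "i = (T ^^ l) b" by (auto simp: min_cyc_eq[OF b])
      have "c (T i) = \<xi> ^ (q ^ Suc l)" using c[of "Suc l"] by (simp add: l)
      also have "\<dots> = c i ^ q" by (simp add: c l mult.commute flip: power_mult)
      finally show ?thesis .
    next
      case False
      have "T i \<notin> min_cyc N q b"
        using closed_cancel[of "min_cyc N q b" i] min_cyc_closed[OF b] i False by blast
      then show ?thesis using False q_gt_1 by (simp add: c_def)
    qed
  qed (simp add: c_def)
  ultimately show ?thesis using that by blast
qed

text \<open>Cycles are split off one at a time. A cycle of length \<open>n\<close> contributes a
  free element of the field with \<open>q ^ n\<close> elements, hence a factor
  \<open>q ^ n\<close>.\<close>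

lemma card_frob_coeffs:
  assumes "D \<subseteq> {..<N}" "T ` D \<subseteq> D"
  shows "card (frob_coeffs D) = q ^ card D"
  using assms
proof (induction "card D" arbitrary: D rule: less_induct)
  case less
  have finD: "finite D" using less.prems(1) finite_subset by blast
  show ?case
  proof (cases "D = {}")
    case True
    have "frob_coeffs {} = {\<lambda>_. 0}" using q_gt_1 by (auto simp: frob_coeffs_def)
    then show ?thesis using True by simp
  next
    case False
    then obtain b where b: "b \<in> D" by blast
    then have bN: "b < N" using less.prems by auto
    let ?O = "min_cyc N q b"
    let ?E = "{x :: 'f alg_closure. x ^ (q ^ card ?O) = x}"
    note per = period[OF bN]
    have OD: "?O \<subseteq> D" using min_cyc_subset_closed[OF less.prems(2) b bN] .
    have self: "b \<in> ?O" by (rule self_mem_min_cyc[OF bN])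
    have Ocl: "T ` ?O \<subseteq> ?O" using min_cyc_closed[OF bN] by blast
    have Onot: "T i \<notin> ?O" if "i < N" "i \<notin> ?O" for i using closed_cancel[OF Ocl that(1)] that(2) by blast
    have D': "D - ?O \<subseteq> {..<N}" "T ` (D - ?O) \<subseteq> D - ?O" using less.prems Onot by auto
    have cardD': "card (D - ?O) = card D - card ?O" "card ?O \<le> card D"
      using OD finD by (simp_all add: card_Diff_subset finite_min_cyc card_mono)
    have "card (D - ?O) < card D" using b self finD by (intro psubset_card_mono) auto
    then have IH: "card (frob_coeffs (D - ?O)) = q ^ card (D - ?O)" using less.hyps D' by blast
    have cardE: "card ?E = q ^ card ?O"
      by (rule card_frob_fixpoints[OF per(1)])
    let ?\<Phi> = "\<lambda>c :: nat \<Rightarrow> 'f alg_closure. (c b, \<lambda>i. if i \<in> ?O then 0 else c i)"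
    have "bij_betw ?\<Phi> (frob_coeffs D) (?E \<times> frob_coeffs (D - ?O))"
      unfolding bij_betw_def
    proof (intro conjI subset_antisym subsetI)
      show "inj_on ?\<Phi> (frob_coeffs D)"
      proof (rule inj_onI, rule ext)
        fix c c' i assume c: "c \<in> frob_coeffs D" "c' \<in> frob_coeffs D" "?\<Phi> c = ?\<Phi> c'"
        show "c i = c' i"
        proof (cases "i \<in> ?O")
          case True
          then obtain k where i: "i = (T ^^ k) b" by (auto simp: min_cyc_eq[OF bN])
          have "c b = c' b" using c(3) by (rule Pair_inject)
          then show ?thesis
            unfolding i frob_coeffs_funpow[OF c(1) bN] frob_coeffs_funpow[OF c(2) bN] by (rule arg_cong)
        next
          case False
          have "(\<lambda>i. if i \<in> ?O then 0 else c i) i = (\<lambda>i. if i \<in> ?O then 0 else c' i) i"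
            by (rule fun_cong[of _ _ i]) (rule Pair_inject[OF c(3)])
          then show ?thesis using False by simp
        qed
      qed
    next
      fix y assume "y \<in> ?\<Phi> ` frob_coeffs D"
      then obtain c where c: "c \<in> frob_coeffs D" "y = ?\<Phi> c" by blast
      have "c b ^ (q ^ card ?O) = c b"
        using frob_coeffs_funpow[OF c(1) bN, of "card ?O"] per(2) by simp
      moreover have "(\<lambda>i. if i \<in> ?O then 0 else c i) \<in> frob_coeffs (D - ?O)"
      proof -
        have "(if T i \<in> ?O then 0 else c (T i)) = (if i \<in> ?O then 0 else c i) ^ q" if i: "i < N" for i
          using c(1) Onot[OF i] Ocl q_gt_1 i by (cases "i \<in> ?O") (auto simp: frob_coeffs_def)
        then show ?thesis using c(1) by (simp add: frob_coeffs_def)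
      qed
      ultimately show "y \<in> ?E \<times> frob_coeffs (D - ?O)" using c(2) by simp
    next
      fix y assume "y \<in> ?E \<times> frob_coeffs (D - ?O)"
      then obtain \<xi> c' where y: "y = (\<xi>, c')" "\<xi> ^ (q ^ card ?O) = \<xi>" "c' \<in> frob_coeffs (D - ?O)" by blast
      obtain e where e: "e \<in> frob_coeffs ?O" "\<And>k. e ((T ^^ k) b) = \<xi> ^ (q ^ k)"
        using orbit_frob_coeffs[OF bN y(2)] by blast
      have eb: "e b = \<xi>" using e(2)[of 0] by simp
      have mem: "(\<lambda>i. e i + c' i) \<in> frob_coeffs D"
        using e(1) y(3) subsetD[OF OD] by (simp add: frob_coeffs_def frob_add) blast
      have eq: "y = ?\<Phi> (\<lambda>i. e i + c' i)"
      proof -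
        have "c' b = 0" using y(3) self by (simp add: frob_coeffs_def)
        moreover have "c' = (\<lambda>i. if i \<in> ?O then 0 else e i + c' i)"
          using e(1) y(3) by (intro ext) (simp add: frob_coeffs_def)
        ultimately show ?thesis using y(1) eb by (metis add.right_neutral)
      qed
      show "y \<in> ?\<Phi> ` frob_coeffs D" by (rule image_eqI[where f = ?\<Phi>, OF eq mem])
    qed
    from bij_betw_same_card[OF this]
    have "card (frob_coeffs D) = card ?E * card (frob_coeffs (D - ?O))"
      by (simp only: card_cartesian_product)
    also have "\<dots> = q ^ card D"
      unfolding cardE IH using cardD' by (simp flip: power_add)
    finally show ?thesis .
  qed
qed

lemma card_code:
  assumes "D \<subseteq> {..<N}" "T ` D \<subseteq> D"
  shows "card (code D) = q ^ card D"
proof -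
  have "bij_betw (\<lambda>w i. if i < N then cf w i else 0) (code D) (frob_coeffs D)"
    unfolding bij_betw_def
  proof (intro conjI subset_antisym subsetI)
    show "inj_on (\<lambda>w i. if i < N then cf w i else 0) (code D)"
    proof (rule inj_onI)
      fix w w' assume w: "w \<in> code D" "w' \<in> code D"
        "(\<lambda>i. if i < N then cf w i else 0) = (\<lambda>i. if i < N then cf w' i else 0)"
      have "cf w i = cf w' i" if "i < N" for i using fun_cong[OF w(3), of i] that by simp
      then show "w = w'" by (rule cf_eq_imp_eq[OF code_words[OF w(1)] code_words[OF w(2)]])
    qed
  next
    fix c assume "c \<in> (\<lambda>w i. if i < N then cf w i else 0) ` code D"
    then obtain w where w: "w \<in> code D" "c = (\<lambda>i. if i < N then cf w i else 0)" by blast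
    show "c \<in> frob_coeffs D"
      using w(1) unfolding frob_coeffs_def w(2) by (simp add: code_def cf_T cyc_mult_less)
  next
    fix c assume c: "c \<in> frob_coeffs D"
    then obtain w where w: "w \<in> words N" "\<And>i. i < N \<Longrightarrow> cf w i = c i" by (rule word_of_coeffs) blast
    have "c i = 0" if "\<not> i < N" for i
      using c that assms(1) by (auto simp: frob_coeffs_def)
    then have "c = (\<lambda>i. if i < N then cf w i else 0)"
      using w(2) by (intro ext) simp
    moreover have "w \<in> code D" using c w by (simp add: code_def frob_coeffs_def)
    ultimately show "c \<in> (\<lambda>w i. if i < N then cf w i else 0) ` code D" by blast
  qed
  from bij_betw_same_card[OF this] show ?thesis by (simp only: card_frob_coeffs[OF assms])
qed

text \<open>
  Delsarte duality: for \<open>y = \<Sum>\<^sub>j w\<^sub>j x\<^sub>j\<^sup>h\<close>, orthogonality to the trace words of \<open>\<xi> x\<^sup>h\<close> says that the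
  trace of \<open>\<xi> y\<close> vanishes for all \<open>\<xi>\<close> in the field of definition of \<open>y\<close>, hence \<open>y = 0\<close>.
\<close>

lemma orthogonal_imp_monomial_sum_0:
  assumes D: "T ` D \<subseteq> D" and h: "h \<in> D" "h < N"
    and w: "w \<in> words N" and orth: "\<And>v. v \<in> code D \<Longrightarrow> dot w v = 0"
  shows "(\<Sum>j<N. to_ac (w ! j) * pts j ^ h) = 0"
proof (rule ccontr)
  define y where "y i = (\<Sum>j<N. to_ac (w ! j) * pts j ^ i)" for i
  assume "(\<Sum>j<N. to_ac (w ! j) * pts j ^ h) \<noteq> 0"
  then have yh: "y h \<noteq> 0" by (simp add: y_def)
  have yT: "y (T i) = y i ^ q" for i
    unfolding y_def frob_sum by (intro sum.cong) (auto simp: power_mult_distrib to_ac_frob power_T pts_N)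
  have yk: "y ((T ^^ k) h) = y h ^ (q ^ k)" for k
    by (induction k) (simp_all add: yT mult.commute flip: power_mult)
  let ?O = "min_cyc N q h"
  define n where "n = card ?O"
  note per = period[OF h(2), folded n_def]
  have cE: "card {x :: 'f alg_closure. x ^ (q ^ n) = x} = q ^ n"
    by (rule card_frob_fixpoints[OF per(1)])
  moreover have "q ^ n > 0" using q_gt_1 by simp
  ultimately have fin: "finite {x :: 'f alg_closure. x ^ (q ^ n) = x}" by (metis card.infinite less_numeral_extra(3))
  \<comment> \<open>The sum is the trace of \<open>y h * \<xi>\<close> from the field with
    \<open>q ^ n\<close> elements down to F_q. It has degree \<open>q ^ (n - 1)\<close> in \<xi>, so
    it is nonzero for some \<xi> of that field.\<close>
  obtain \<xi> where \<xi>: "\<xi> ^ (q ^ n) = \<xi>" "(\<Sum>k<n. y h ^ (q ^ k) * \<xi> ^ (q ^ k)) \<noteq> 0"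
    using linearized_poly_nonvanishing[OF q_gt_1 per(1), of "\<lambda>k. y h ^ (q ^ k)", OF _ fin] yh cE
    by auto
  obtain c where c: "c \<in> frob_coeffs ?O" "\<And>k. c ((T ^^ k) h) = \<xi> ^ (q ^ k)"
    using orbit_frob_coeffs[OF h(2)] \<xi>(1) unfolding n_def by blast
  obtain v where v: "v \<in> words N" "\<And>j. j < N \<Longrightarrow> to_ac (v ! j) = (\<Sum>i<N. c i * pts j ^ i)"
    "\<And>i. i < N \<Longrightarrow> cf v i = c i"
    using word_of_coeffs[OF c(1)] by blast
  have "?O \<subseteq> D" using min_cyc_subset_closed[OF D h] .
  then have "v \<in> code D" using v c(1) by (auto simp: code_def frob_coeffs_def)
  then have "to_ac (dot w v) = 0" using orth by simp
  then have "0 = (\<Sum>j<N. to_ac (w ! j) * (\<Sum>i<N. c i * pts j ^ i))"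
    using w v(2) by (simp add: dot_def words_def to_ac_sum)
  also have "\<dots> = (\<Sum>i<N. c i * y i)"
    unfolding y_def sum_distrib_left by (subst sum.swap) (simp only: mult.left_commute)
  also have "\<dots> = (\<Sum>i\<in>?O. c i * y i)"
    using c(1) min_cyc_subset by (intro sum.mono_neutral_right) (auto simp: frob_coeffs_def)
  also have "\<dots> = (\<Sum>k<n. c ((T ^^ k) h) * y ((T ^^ k) h))"
    by (rule sum.reindex_bij_betw[OF per(3), symmetric])
  also have "\<dots> = (\<Sum>k<n. y h ^ (q ^ k) * \<xi> ^ (q ^ k))"
    by (simp only: c(2) yk mult.commute)
  finally show False using \<xi>(2) by simp
qed

text \<open>Up to sign, coefficient \<open>i\<close> of \<open>w\<close> is its pairing with
  \<open>x ^ (N - 1 - i)\<close>, an exponent of \<open>perp N D\<close> when \<open>i\<close> is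
  outside \<open>D\<close>. The dual monomial of exponent 0 has an additional constant, but 0 lies
  in \<open>D\<close>.\<close>

lemma orthogonal_perp_imp_code:
  assumes D: "D \<subseteq> {..<N}" "T ` D \<subseteq> D" "0 \<in> D" "N - 1 \<notin> D"
    and w: "w \<in> words N" "\<And>v. v \<in> code (perp N D) \<Longrightarrow> dot w v = 0"
  shows "w \<in> code D"
  unfolding code_def
proof (intro CollectI conjI w allI impI)
  fix i assume i: "i < N" "i \<notin> D"
  then have "i \<noteq> 0" using D(3) by metis
  have "N - 1 - i \<in> perp N D" using i N by (simp add: mem_perp_iff[OF D(1)])
  then have "(\<Sum>j<N. to_ac (w ! j) * pts j ^ (N - 1 - i)) = 0"
    by (rule orthogonal_imp_monomial_sum_0[OF perp_closed[OF D] _ _ w]) (use N in linarith)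
  moreover have "cf w i = - (\<Sum>j<N. to_ac (w ! j) * pts j ^ (N - 1 - i))"
    using \<open>i \<noteq> 0\<close> by (simp add: cf_def dual_monom_def sum_negf)
  ultimately show "cf w i = 0" by simp
qed

section \<open>Minimum distance of the extended codes\<close>

lemma indicator_word:
  assumes "d < N"
  obtains v where "v \<in> words N" "\<And>i. i < N \<Longrightarrow> cf v i = of_bool (i \<in> min_cyc N q d)"
proof -
  have "T i \<in> min_cyc N q d \<longleftrightarrow> i \<in> min_cyc N q d" if "i < N" for i
    using closed_cancel[of "min_cyc N q d" i] min_cyc_closed[OF assms] that by blast
  then have "(\<lambda>i. of_bool (i \<in> min_cyc N q d)) \<in> frob_coeffs (min_cyc N q d)"
    using q_gt_1 by (simp add: frob_coeffs_def)
  then obtain w where "w \<in> words N" "\<And>i. i < N \<Longrightarrow> cf w i = of_bool (i \<in> min_cyc N q d)"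
    by (rule word_of_coeffs) blast
  then show ?thesis by (rule that)
qed

lemma card_nonzero_entries:
  assumes w: "w \<in> words N" and e: "e \<le> N" "\<And>i. i < N \<Longrightarrow> e \<le> i \<Longrightarrow> cf w i = 0"
    and "i0 < N" "cf w i0 \<noteq> 0"
  shows "card {j. j < N \<and> w ! j \<noteq> 0} > N - e"
proof -
  have "i0 < e" using e(2) assms(4,5) by (meson not_le)
  have sum: "(\<Sum>i<e. cf w i * pts j ^ i) = to_ac (w ! j)" if "j < N" for j
  proof -
    have "(\<Sum>i<e. cf w i * pts j ^ i) = (\<Sum>i<N. cf w i * pts j ^ i)"
      using e by (intro sum.mono_neutral_left) auto
    then show ?thesis using interpolation[OF that] by simp
  qed
  have "{j \<in> {..<N}. (\<Sum>i<e. cf w i * pts j ^ i) = 0} = {j. j < N \<and> w ! j = 0}"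
    using sum by auto
  then have "card {j. j < N \<and> w ! j = 0} < e"
    using card_poly_zeros_less[of i0 e "cf w" pts "{..<N}"] \<open>i0 < e\<close> assms(5) inj_pts by simp
  moreover have "card {j. j < N \<and> w ! j = 0} + card {j. j < N \<and> w ! j \<noteq> 0} = N"
  proof -
    have "card {j. j < N \<and> w ! j = 0} + card {j. j < N \<and> w ! j \<noteq> 0}
        = card ({j. j < N \<and> w ! j = 0} \<union> {j. j < N \<and> w ! j \<noteq> 0})"
      by (rule card_Un_disjoint[symmetric]) auto
    also have "{j. j < N \<and> w ! j = 0} \<union> {j. j < N \<and> w ! j \<noteq> 0} = {..<N}" by auto
    finally show ?thesis by simp
  qed
  ultimately show ?thesis using e(1) by linarith
qed

text \<open>If \<beta> is nonzero, the polynomial of \<open>y\<close> has degree exactly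
  \<open>d\<close>, since \<open>d\<close> is the largest element of its cyclotomic set: at most
  \<open>d\<close> zeros, and the appended symbol supplies the missing unit of weight. If \<beta> =
  0, the degree is below \<open>d\<close>, and \<open>y\<close> alone, unless it is zero, has weight
  above \<open>N - d\<close>.\<close>

lemma extended_weight:
  assumes d: "d \<in> max_reps N q" and v: "v \<in> words N" "\<And>i. i < N \<Longrightarrow> cf v i = of_bool (i \<in> min_cyc N q d)"
    and D: "D \<subseteq> {..<d}" and y: "y \<in> words N" "map2 (-) y (map ((*) \<beta>) v) \<in> code D"
    and wt: "hamming_weight (y @ [\<beta>]) < N - d + 1"
  shows "y @ [\<beta>] = replicate (N + 1) 0"
proof -
  have dN: "d < N" and dmax: "Max (min_cyc N q d) = d" using d by (auto simp: max_reps_iff)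
  have cf_y: "cf y i = to_ac \<beta> * of_bool (i \<in> min_cyc N q d)" if "i < N" "d \<le> i" for i
  proof -
    have "i \<notin> D" using that D by auto
    then have "cf (map2 (-) y (map ((*) \<beta>) v)) i = 0" using that y(2) by (simp add: code_def)
    then show ?thesis using cf_diff[OF y(1), of "map ((*) \<beta>) v" i] v(1) v(2)[OF that(1)]
      by (simp add: cf_scale) (simp add: words_def)
  qed
  have above: "i \<notin> min_cyc N q d" if "d < i" for i
    using Max_ge[OF finite_min_cyc, of i d] dmax that by fastforce
  have len: "length y = N" using y(1) by (simp add: words_def)
  have wt_y: "hamming_weight (y @ [\<beta>]) = card {j. j < N \<and> y ! j \<noteq> 0} + of_bool (\<beta> \<noteq> 0)"
  proof -
    have "{i. i < length (y @ [\<beta>]) \<and> (y @ [\<beta>]) ! i \<noteq> 0}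
        = {j. j < N \<and> y ! j \<noteq> 0} \<union> (if \<beta> \<noteq> 0 then {N} else {})"
      using len by (auto simp: nth_append less_Suc_eq)
    then show ?thesis by (simp add: hamming_weight_def card_insert_if)
  qed
  show ?thesis
  proof (cases "\<beta> = 0")
    case False
    have "cf y d \<noteq> 0" using cf_y[of d] dN False self_mem_min_cyc[OF dN] by simp
    then have "card {j. j < N \<and> y ! j \<noteq> 0} > N - (d + 1)"
      using dN above cf_y by (intro card_nonzero_entries[OF y(1), of "d + 1" d]) auto
    then show ?thesis using wt wt_y False dN by simp
  next
    case True
    have "cf y i = 0" if "i < N" for i
    proof (rule ccontr)
      assume "cf y i \<noteq> 0"
      then have "card {j. j < N \<and> y ! j \<noteq> 0} > N - d"
        using that dN cf_y True by (intro card_nonzero_entries[OF y(1), of d i]) auto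
      then show False using wt wt_y by simp
    qed
    then have "to_ac (y ! j) = 0" if "j < N" for j using interpolation[OF that, of y] by simp
    then have "y = replicate N 0" using len by (intro nth_equalityI) auto
    then show ?thesis using True by (simp flip: replicate_append_same)
  qed
qed

end

section \<open>The extended codes\<close>

lemma dot_diff:
  fixes x :: "'f::comm_ring_1 list"
  assumes "x \<in> words n" "y \<in> words n"
  shows "dot (map2 (-) x y) v = dot x v - dot y v"
  using assms by (simp add: dot_def words_def left_diff_distrib sum_subtractf)

lemma dot_scale: "dot (map ((*) c) x) v = c * dot x v"
  for c :: "'f::comm_ring_1"
  by (simp add: dot_def sum_distrib_left mult.assoc)

lemma dot_commute:
  fixes x :: "'f::comm_ring_1 list"
  assumes "x \<in> words n" "y \<in> words n"
  shows "dot x y = dot y x"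
  using assms by (simp add: dot_def words_def mult.commute)

lemma dot_snoc:
  fixes x :: "'f::comm_ring_1 list"
  assumes "x \<in> words n" "x' \<in> words n"
  shows "dot (x @ [c]) (x' @ [c']) = dot x x' + c * c'"
proof -
  have "(\<Sum>i<n. (x @ [c]) ! i * (x' @ [c']) ! i) = dot x x'"
    unfolding dot_def using assms by (intro sum.cong) (auto simp: words_def nth_append)
  then show ?thesis using assms by (simp add: dot_def words_def nth_append)
qed

context evaluation_code
begin

text \<open>The equation for \<kappa> compares dimensions: \<open>S\<close> has dimension
  \<open>card D2 + 2\<close>, with two free symbols \<beta> and \<tau>, and \<open>G\<close> has
  dimension \<open>N - card D1\<close>. The sum form avoids truncated subtraction.\<close>

lemma asymmetric_code:
  assumes d: "d1 \<in> max_reps N q" "d1 \<ge> 1" "d2 \<in> max_reps N q"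
    and sub: "perp N (cyc_part N q ({0..d1} - {d1})) \<subseteq> cyc_part N q ({0..d2} - {d2})"
    and \<kappa>: "\<kappa> + N = card (cyc_part N q ({0..d1} - {d1})) + card (cyc_part N q ({0..d2} - {d2})) + 2"
    and \<omega>: "\<omega> ^ CHAR('f) = (1 :: complex)" "\<forall>k. 0 < k \<and> k < CHAR('f) \<longrightarrow> \<omega> ^ k \<noteq> 1"
  shows "\<exists>Q :: 'f qvec set. asymmetric_eaqecc \<omega> (N + 1) \<kappa> (N - d1 + 1) (N - d2 + 1) 1 Q"
proof -
  define D1 where "D1 = cyc_part N q ({0..d1} - {d1})"
  define D2 where "D2 = cyc_part N q ({0..d2} - {d2})"
  have dN: "d1 < N" "d2 < N" using d by (auto simp: max_reps_iff)
  have D1: "D1 \<subseteq> {..<d1}" "T ` D1 \<subseteq> D1" and D2: "D2 \<subseteq> {..<d2}" "T ` D2 \<subseteq> D2"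
    using cyc_part_subset[of "{0..d1} - {d1}"] cyc_part_subset[of "{0..d2} - {d2}"]
    by (auto simp: D1_def D2_def intro!: cyc_part_closed)
  have D1N: "D1 \<subseteq> {..<N}" and D2N: "D2 \<subseteq> {..<N}" using D1 D2 dN by auto
  have zero: "0 \<in> D1"
    using N d(2) by (auto simp: D1_def cyc_part_eq min_cyc_def)
  have top: "N - 1 \<notin> D1" using D1(1) dN by auto
  note perp = perp_closed[OF D1N D1(2) zero top]
  let ?C = "code (perp N D1)"
  have CC: "?C \<subseteq> code D2" using code_mono sub by (simp add: D1_def D2_def)
  obtain v1 where v1: "v1 \<in> words N" "\<And>i. i < N \<Longrightarrow> cf v1 i = of_bool (i \<in> min_cyc N q d1)"
    using indicator_word[OF dN(1)] by blast
  obtain v2 where v2: "v2 \<in> words N" "\<And>i. i < N \<Longrightarrow> cf v2 i = of_bool (i \<in> min_cyc N q d2)"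
    using indicator_word[OF dN(2)] by blast
  have v1_notin: "v1 \<notin> code D1"
  proof
    assume "v1 \<in> code D1"
    moreover have "d1 \<notin> D1" using D1(1) by auto
    ultimately have "cf v1 d1 = 0" using dN(1) by (simp add: code_def)
    then show False using v1(2)[OF dN(1)] self_mem_min_cyc[OF dN(1)] by simp
  qed
  have v2_scale: "c = 0" if "map ((*) c) v2 \<in> code D2" for c
  proof -
    have "d2 \<notin> D2" using D2(1) by auto
    then have "cf (map ((*) c) v2) d2 = 0" using that dN(2) by (simp add: code_def)
    then show ?thesis using v2(2)[OF dN(2)] self_mem_min_cyc[OF dN(2)] by (simp add: cf_scale[OF v2(1)])
  qed
  \<comment> \<open>\<open>G\<close> is the dual of the first extended code, each word prolonged by its receiver symbol
    \<open>\<tau> = \<langle>y, v1\<rangle>\<close>; \<open>S\<close> is generated by \<open>G\<close> and the second extended code with receiver symbol 0.\<close>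
  define S where "S = {y @ [\<beta>, \<tau>] |y \<beta> \<tau>. y \<in> words N \<and> map2 (-) y (map ((*) (\<beta> + \<tau>)) v2) \<in> code D2}"
  define G where "G = (\<lambda>y. y @ [- dot y v1, dot y v1]) ` ?C"
  have SI: "y @ [\<beta>, \<tau>] \<in> S \<longleftrightarrow> y \<in> words N \<and> map2 (-) y (map ((*) (\<beta> + \<tau>)) v2) \<in> code D2" for y \<beta> \<tau>
    by (auto simp: S_def)
  show ?thesis
  proof (rule css_asymmetric_eaqecc[of \<omega> \<kappa> "N + 1" S G])
    have p: "prime CHAR('f)" by simp
    have card: "CARD('f) = CHAR('f) ^ r" using q by simp
    show "\<omega> ^ trace_rep (x + y :: 'f) = \<omega> ^ trace_rep x * \<omega> ^ trace_rep y" for x y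
      by (rule trace_char_add[OF p q(2) card \<omega>(1)])
    show "\<omega> ^ trace_rep (0 :: 'f) = 1" by (simp add: trace_rep_0[OF p q(2) card])
    show "\<exists>c. \<omega> ^ trace_rep (c * x) \<noteq> 1" if "x \<noteq> 0" for x :: 'f
      by (rule trace_char_nontrivial[OF p q(2) card \<omega>(2) that])
    \<comment> \<open>Each \<open>card Di\<close> is at most \<open>di\<close>, hence at most
      \<open>N - 1\<close>, so \<kappa> is at most \<open>2 * (N - 1) + 2 - N = N\<close>.\<close>
    show "\<kappa> + 1 \<le> N + 1"
    proof -
      have "card D1 \<le> d1" "card D2 \<le> d2" using D1(1) D2(1) subset_eq_atLeast0_lessThan_card by (auto simp: atLeast0LessThan)
      then show ?thesis using \<kappa> dN unfolding D1_def D2_def by linarith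
    qed
    show "S \<subseteq> words (N + 1 + 1)" by (auto simp: S_def words_def)
    show "map2 (-) x y \<in> S" if xy: "x \<in> S" "y \<in> S" for x y
    proof -
      obtain a \<beta> \<tau> a' \<beta>' \<tau>' where a: "x = a @ [\<beta>, \<tau>]" "y = a' @ [\<beta>', \<tau>']" "a \<in> words N" "a' \<in> words N"
        "map2 (-) a (map ((*) (\<beta> + \<tau>)) v2) \<in> code D2" "map2 (-) a' (map ((*) (\<beta>' + \<tau>')) v2) \<in> code D2"
        using xy by (auto simp: S_def)
      have "map2 (-) (map2 (-) a (map ((*) (\<beta> + \<tau>)) v2)) (map2 (-) a' (map ((*) (\<beta>' + \<tau>')) v2))
          = map2 (-) (map2 (-) a a') (map ((*) (\<beta> - \<beta>' + (\<tau> - \<tau>'))) v2)"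
        using a(3,4) v2(1) by (auto simp: words_def list_eq_iff_nth_eq algebra_simps)
      then have "map2 (-) a a' @ [\<beta> - \<beta>', \<tau> - \<tau>'] \<in> S"
        unfolding SI using code_diff[OF a(5,6)] vdiff_in_words[OF a(3,4)] by simp
      then show ?thesis using a(3,4) by (simp add: a(1,2) words_def)
    qed
    show "G \<subseteq> S"
    proof
      fix g assume "g \<in> G"
      then obtain y where y: "y \<in> ?C" "g = y @ [- dot y v1, dot y v1]" by (auto simp: G_def)
      have "map2 (-) y (map ((*) 0) v2) = y"
        using code_words[OF y(1)] v2(1) by (auto simp: words_def list_eq_iff_nth_eq)
      then show "g \<in> S" unfolding y(2) SI using y(1) CC code_words[OF y(1)] by auto
    qed
    show "map2 (-) x y \<in> G" if xy: "x \<in> G" "y \<in> G" for x y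
    proof -
      obtain a a' where a: "a \<in> ?C" "a' \<in> ?C" "x = a @ [- dot a v1, dot a v1]" "y = a' @ [- dot a' v1, dot a' v1]"
        using xy by (auto simp: G_def)
      have "map2 (-) x y = map2 (-) a a' @ [- dot (map2 (-) a a') v1, dot (map2 (-) a a') v1]"
        using code_words[OF a(1)] code_words[OF a(2)]
        by (simp add: a(3,4) words_def dot_diff[of _ N])
      then show ?thesis unfolding G_def using code_diff[OF a(1,2)] by blast
    qed
    show "map ((*) c) x \<in> G" if x: "x \<in> G" for c x
    proof -
      obtain a where a: "a \<in> ?C" "x = a @ [- dot a v1, dot a v1]" using x by (auto simp: G_def)
      have "map ((*) c) x = map ((*) c) a @ [- dot (map ((*) c) a) v1, dot (map ((*) c) a) v1]"
        by (simp add: a(2) dot_scale)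
      then show ?thesis unfolding G_def using code_scale[OF a(1)] by blast
    qed
    show "t = 0" if "replicate (N + 1) 0 @ [t] \<in> S" for t
    proof -
      have "replicate N 0 @ [0, t] \<in> S" using that by (simp flip: replicate_append_same)
      then have "map2 (-) (replicate N 0) (map ((*) t) v2) \<in> code D2" unfolding SI by simp
      moreover have "map2 (-) (replicate N 0) (map ((*) t) v2) = map ((*) (- t)) v2"
        using v2(1) by (auto simp: words_def list_eq_iff_nth_eq)
      ultimately show "t = 0" using v2_scale by fastforce
    qed
    show "\<exists>g\<in>G. last g = 1"
    proof -
      \<comment> \<open>By duality a word orthogonal to all of \<open>?C\<close> would lie in
        \<open>code D1\<close>, and \<open>v1\<close> does not. Scaling then gives receiver symbol
        1.\<close>
      have "\<exists>w\<in>?C. dot v1 w \<noteq> 0"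
        using orthogonal_perp_imp_code[OF D1N D1(2) zero top v1(1)] v1_notin by blast
      then obtain w where w: "w \<in> ?C" "dot w v1 \<noteq> 0"
        using dot_commute[OF v1(1) code_words] by metis
      have "dot (map ((*) (1 / dot w v1)) w) v1 = 1" using w(2) by (simp add: dot_scale)
      then show ?thesis unfolding G_def using code_scale[OF w(1), of "1 / dot w v1"] by fastforce
    qed
    show "card S = CARD('f) ^ \<kappa> * card G"
    proof -
      have "bij_betw (\<lambda>(x, \<beta>, \<tau>). map2 (+) x (map ((*) (\<beta> + \<tau>)) v2) @ [\<beta>, \<tau>])
          (code D2 \<times> (UNIV :: 'f set) \<times> (UNIV :: 'f set)) S" (is "bij_betw ?h ?A S")
        unfolding bij_betw_def
      proof (intro conjI subset_antisym subsetI)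
        have cancel: "map2 (-) (map2 (+) x (map ((*) c) v2)) (map ((*) c) v2) = x"
          "map2 (+) (map2 (-) x (map ((*) c) v2)) (map ((*) c) v2) = x"
          if "x \<in> words N" for x c
          using that v2(1) by (auto simp: words_def list_eq_iff_nth_eq)
        show "inj_on ?h ?A"
        proof (rule inj_onI)
          fix s s' assume s: "s \<in> ?A" "s' \<in> ?A" "?h s = ?h s'"
          obtain x \<beta> \<tau> x' \<beta>' \<tau>' where eq: "s = (x, \<beta>, \<tau>)" "s' = (x', \<beta>', \<tau>')" by (cases s; cases s') auto
          have x: "x \<in> words N" "x' \<in> words N" using s(1,2) code_words by (auto simp: eq)
          have h: "\<beta> = \<beta>'" "\<tau> = \<tau>'"
            using s(3) by (simp_all add: eq)
          have "map2 (+) x (map ((*) (\<beta> + \<tau>)) v2) = map2 (+) x' (map ((*) (\<beta> + \<tau>)) v2)"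
            using s(3) h by (simp add: eq)
          then have "x = x'" using cancel(1)[OF x(1), of "\<beta> + \<tau>"] cancel(1)[OF x(2), of "\<beta> + \<tau>"] by metis
          then show "s = s'" using h by (simp add: eq)
        qed
        show "s \<in> S" if s: "s \<in> ?h ` ?A" for s
        proof -
          obtain x \<beta> \<tau> where x: "x \<in> code D2" "s = map2 (+) x (map ((*) (\<beta> + \<tau>)) v2) @ [\<beta>, \<tau>]"
            using s by auto
          have "map2 (+) x (map ((*) (\<beta> + \<tau>)) v2) \<in> words N"
            using code_words[OF x(1)] v2(1) by (simp add: words_def)
          then show ?thesis unfolding x(2) SI cancel(1)[OF code_words[OF x(1)]] using x(1) by blast
        qed
        show "s \<in> ?h ` ?A" if s: "s \<in> S" for s
        proof -
          obtain y \<beta> \<tau> where y: "s = y @ [\<beta>, \<tau>]" "y \<in> words N" "map2 (-) y (map ((*) (\<beta> + \<tau>)) v2) \<in> code D2"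
            using s by (auto simp: S_def)
          then have "?h (map2 (-) y (map ((*) (\<beta> + \<tau>)) v2), \<beta>, \<tau>) = s" by (simp add: cancel(2))
          then show ?thesis using y(3) by (metis (no_types, lifting) SigmaI UNIV_I imageI)
        qed
      qed
      from bij_betw_same_card[OF this] have "card S = q ^ card D2 * (q * q)"
        using card_code[OF D2N D2(2)] q(3) by (simp add: card_cartesian_product)
      moreover have "card G = q ^ (N - card D1)"
      proof -
        have "inj_on (\<lambda>y. y @ [- dot y v1, dot y v1]) ?C" by (rule inj_onI) auto
        moreover have "perp N D1 \<subseteq> {..<N}" by (auto simp: perp_def)
        ultimately show ?thesis
          unfolding G_def using card_code[OF _ perp] by (simp add: card_image card_perp[OF D1N])
      qed
      moreover have "card D2 + 2 = \<kappa> + (N - card D1)"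
        using \<kappa> card_mono[OF _ D1N] unfolding D1_def D2_def by simp
      then have "q ^ card D2 * (q * q) = q ^ \<kappa> * q ^ (N - card D1)"
        by (metis power_add power2_eq_square)
      ultimately show ?thesis using q(3) by simp
    qed
    show "a = replicate (N + 1) 0"
      if a: "a \<in> words (N + 1)" "a @ [0] \<in> S" "hamming_weight a < N - d2 + 1" for a
    proof -
      obtain y \<beta> where y: "a = y @ [\<beta>]" "y \<in> words N"
        using a(1) by (cases a rule: rev_cases) (auto simp: words_def)
      have "y @ [\<beta>, 0] \<in> S" using a(2) y(1) by simp
      then have "map2 (-) y (map ((*) \<beta>) v2) \<in> code D2" unfolding SI by simp
      then show ?thesis
        unfolding y(1) by (intro extended_weight[OF d(3) v2 D2(1) y(2)]) (use a(3) y(1) in auto)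
    qed
    show "b = replicate (N + 1) 0"
      if b: "b \<in> words (N + 1)" "\<And>g. g \<in> G \<Longrightarrow> dot b (take (N + 1) g) = 0" "hamming_weight b < N - d1 + 1" for b
    proof -
      obtain y \<beta> where y: "b = y @ [\<beta>]" "y \<in> words N"
        using b(1) by (cases b rule: rev_cases) (auto simp: words_def)
      \<comment> \<open>Orthogonality of \<open>b\<close> to the sender parts of \<open>G\<close>
        says that \<open>y - \<beta> v1\<close> is orthogonal to \<open>?C\<close>, so duality puts
        \<open>b\<close> into the first extended code.\<close>
      have "map2 (-) y (map ((*) \<beta>) v1) \<in> code D1"
      proof (rule orthogonal_perp_imp_code[OF D1N D1(2) zero top])
        show "map2 (-) y (map ((*) \<beta>) v1) \<in> words N" using y(2) v1(1) by (simp add: words_def)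
        fix w assume w: "w \<in> ?C"
        have wN: "w \<in> words N" by (rule code_words[OF w])
        have "w @ [- dot w v1, dot w v1] \<in> G" using w by (simp add: G_def)
        from b(2)[OF this] have "dot (y @ [\<beta>]) (w @ [- dot w v1]) = 0"
          using wN by (simp add: y(1) words_def)
        then have "dot y w - \<beta> * dot w v1 = 0"
          by (simp add: dot_snoc[OF y(2) wN])
        then show "dot (map2 (-) y (map ((*) \<beta>) v1)) w = 0"
          using y(2) v1(1) dot_commute[OF wN v1(1)] by (simp add: dot_diff[of _ N] dot_scale words_def)
      qed
      then show ?thesis
        unfolding y(1) by (intro extended_weight[OF d(1) v1 D1(1) y(2)]) (use b(3) y(1) in auto)
    qed
  qed
qed

end

theorem theorem5p11:
  fixes p q r s N d1 d2 :: nat and \<omega> :: complex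
  assumes "prime p" and "r \<ge> 1" and "q = p ^ r"
    and "CARD('f::finite_field) = q"
    and "\<omega> ^ p = 1" and "\<forall>k. 0 < k \<and> k < p \<longrightarrow> \<omega> ^ k \<noteq> 1"
    and "s \<ge> 1" and "N > 1" and "(N - 1) dvd (q ^ s - 1)" and "p dvd N"
    and "1 \<le> d1" and "d1 \<le> N - 1" and "d1 \<in> max_reps N q"
    and "1 \<le> d2" and "d2 \<le> N - 1" and "d2 \<in> max_reps N q"
    and "perp N (cyc_part N q ({0..d1} - {d1})) \<subseteq> cyc_part N q ({0..d2} - {d2})"
  shows "\<exists>\<kappa> \<delta>z \<delta>x (Q :: 'f qvec set).
           int \<kappa> = (\<Sum>b\<in>{b \<in> max_reps N q. b < d1}. int (card (min_cyc N q b)))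
                 + (\<Sum>b\<in>{b \<in> max_reps N q. b < d2}. int (card (min_cyc N q b)))
                 + 2 - int N \<and>
           \<delta>z \<ge> N - d1 + 1 \<and> \<delta>x \<ge> N - d2 + 1 \<and>
           asymmetric_eaqecc \<omega> (N + 1) \<kappa> \<delta>z \<delta>x 1 Q"
proof -
  have char: "CHAR('f) = p" by (rule finite_field_CHAR[OF assms(1,2)]) (use assms(3,4) in simp)
  \<comment> \<open>The prime \<open>p\<close> cannot divide two consecutive numbers; this makes
    \<open>q\<close> invertible modulo \<open>N - 1\<close>.\<close>
  have "\<not> p dvd N - 1"
  proof
    assume "p dvd N - 1"
    then have "p dvd 1" using dvd_diffD1[OF _ assms(10), of 1] assms(8) by simp
    then show False using assms(1) by simp
  qed
  then have "coprime p (N - 1)" using assms(1) by (simp add: prime_imp_coprime)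
  then have coprime: "coprime q (N - 1)" unfolding assms(3) by simp
  have "card {x :: 'f alg_closure. x ^ N = x} = N"
    using assms(8,10) by (intro card_power_fixpoints_alg_closure) (simp_all add: char)
  then obtain pts where pts: "bij_betw pts {..<N} {x :: 'f alg_closure. x ^ N = x}"
    using ex_bij_betw_nat_finite[OF card_ge_0_finite, of "{x :: 'f alg_closure. x ^ N = x}"] assms(8)
    by (auto simp: atLeast0LessThan)
  interpret evaluation_code N q pts r
    by (unfold_locales, unfold char) (fact assms coprime pts)+
  let ?D1 = "cyc_part N q ({0..d1} - {d1})" and ?D2 = "cyc_part N q ({0..d2} - {d2})"
  have D1N: "?D1 \<subseteq> {..<N}" using cyc_part_eq by auto
  \<comment> \<open>The inclusion of \<open>perp\<close> gives
    \<open>N \<le> card ?D1 + card ?D2\<close>, so the number of logical qudits is a natural number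
    and the subtraction defining it is exact.\<close>
  have "N - card ?D1 \<le> card ?D2"
  proof -
    have "finite ?D2" by (simp add: cyc_part_eq)
    then show ?thesis using card_mono[OF _ assms(17)] card_perp[OF D1N] by simp
  qed
  then have "\<exists>\<kappa>. \<kappa> + N = card ?D1 + card ?D2 + 2"
    by (intro exI[of _ "card ?D1 + card ?D2 + 2 - N"]) linarith
  then obtain \<kappa> where \<kappa>: "\<kappa> + N = card ?D1 + card ?D2 + 2" by blast
  obtain Q :: "'f qvec set" where Q: "asymmetric_eaqecc \<omega> (N + 1) \<kappa> (N - d1 + 1) (N - d2 + 1) 1 Q"
    using asymmetric_code[OF assms(13,11,16,17) \<kappa>, unfolded char, OF assms(5,6)] by blast
  have "int \<kappa> = int (card ?D1) + int (card ?D2) + 2 - int N" using \<kappa> by linarith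
  then show ?thesis
    using Q unfolding card_cyc_part_below of_nat_sum by blast
qed

end
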